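(* For any composition $\alpha=(\alpha_1,\ldots,\alpha_\ell)$ of $n$ (positive parts, $\ell(\alpha)=\ell$), with partial sums $\sigma_i:=\sum_{j=1}^i\alpha_j$ ($\sigma_0=0$), one has $$r_\alpha=\sum_{\beta}(-1)^{\ell(\alpha)-\ell(\beta)}\binom n\beta=n!\,\det\left(\frac1{(\sigma_j-\sigma_{i-1})!}\right)_{i,j=1}^{\ell(\alpha)},$$ $$r_\alpha(q)=\sum_{\beta}(-1)^{\ell(\alpha)-\ell(\beta)}\left[\begin{matrix} n\\\beta\end{matrix}\right]_q=[n]!_q\,\det\left(\frac1{[\sigma_j-\sigma_{i-1}]!_q}\right)_{i,j=1}^{\ell(\alpha)},$$ $$r_\alpha(q,t)=\sum_{\beta}(-1)^{\ell(\alpha)-\ell(\beta)}\left[\begin{matrix} n\\\beta\end{matrix}\right]_{q,t}=n!_{q,t}\,\det\left(\varphi^{\sigma_{i-1}}\frac1{(\sigma_j-\sigma_{i-1})!_{q,t}}\right)_{i,j=1}^{\ell(\alpha)},$$ where each sum is over all compositions $\beta$ of $n$ that are refined by $\alpha$, $\ell(\beta)$ is the number of parts of $\beta$, and reciprocals of factorials of negative integers are interpreted as $0$.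
   Context: Ring: $\hat{\mathbb Q}(\mathbf t)$ is the field of rational functions over $\mathbb Q$ in algebraically independent indeterminates denoted $t^{q^r}$, $r\in\mathbb Z$ ($t=t^{q^0}$; $q$ formal). For $f(q)=\sum_rc_rq^r$ write $t^{f(q)}:=\prod_r(t^{q^r})^{c_r}$. The automorphism $\varphi$ sends $t^{q^r}\mapsto t^{q^{r+1}}$, and $F(q,t^{q^m}):=\varphi^mF(q,t)$. Put $n!_{q,t}:=\prod_{i=0}^{n-1}(1-t^{q^n-q^i})$, $[m]!_q:=\prod_{j=1}^m(1+q+\cdots+q^{j-1})$. Multinomials: for $\beta=(\beta_1,\ldots,\beta_p)$, $\binom n\beta=\frac{n!}{\prod\beta_s!}$, $\left[\begin{smallmatrix} n\\\beta\end{smallmatrix}\right]_q=\frac{[n]!_q}{\prod_s[\beta_s]!_q}$, and $\left[\begin{smallmatrix} n\\\beta\end{smallmatrix}\right]_{q,t}:=n!_{q,t}\big/\prod_{s=1}^p\beta_s!_{q,t^{q^{\beta_1+\cdots+\beta_{s-1}}}}$. "$\beta$ is refined by $\alpha$" means the set of partial sums of $\beta$ is contained in that of $\alpha$. Ribbon numbers: for $w\in W=\mathfrak S_n$ the descent composition $\beta(w)$ lists the lengths of the maximal increasing consecutive runs of $w(1),\ldots,w(n)$, and $\ell(w)$ is the number of inversions. Define $r_\alpha:=|\{w\in W:\beta(w)=\alpha\}|$, $r_\alpha(q):=\sum_{w:\beta(w)=\alpha}q^{\ell(w)}$, $r_\alpha(q,t):=\sum_{w:\beta(w)=\alpha}\mathrm{wt}(w;q,t)$.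 The permutations $u_\lambda$: for a partition $\lambda$ inside a $k\times(n-k)$ rectangle, $u_\lambda\in\mathfrak S_n$ is the permutation increasing on $\{1,\ldots,k\}$ and on $\{k+1,\ldots,n\}$ with $u_\lambda(i)=\lambda_{k+1-i}+i$ for $i=1,\ldots,k$. Weight: $\mathrm{wt}(w;q,t)\in\hat{\mathbb Q}(\mathbf t)$ for $w\in\mathfrak S_n$ is defined recursively: it is $1$ if $n\le1$. Otherwise let $w^{-1}(1)=k+1$ and factor uniquely $w=u_\lambda\cdot a\cdot e\cdot b$ (so $w(i)=u_\lambda(a(i))$ for $i\le k$, etc.) with $\lambda$ inside a $k\times(n-k)$ rectangle, $a\in\mathfrak S_{\{1,\ldots,k\}}\cong\mathfrak S_k$, $e$ the identity on $\{k+1\}$, and $b\in\mathfrak S_{\{k+2,\ldots,n\}}\cong\mathfrak S_{n-k-1}$. Here $\lambda$ has exactly $k$ nonzero parts; let $\hat\lambda=(\lambda_1-1,\ldots,\lambda_k-1)$, inside a $k\times(n-1-k)$ rectangle, so $u_{\hat\lambda}\in\mathfrak S_{n-1}$. Set $$\mathrm{wt}(w;q,t):=t^{q^k-1}\frac{k!_{q,t^q}}{k!_{q,t}}\cdot\mathrm{wt}(u_{\hat\lambda};q,t^q)\,\mathrm{wt}(a;q,t)\,\mathrm{wt}(b;q,t^{q^{k+1}}).$$ *)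

theory Defs
  imports
    "HOL-Library.Poly_Mapping"
    "HOL-Computational_Algebra.Polynomial"
    "HOL-Computational_Algebra.Fraction_Field"
    "HOL-Combinatorics.Permutations"
    "Jordan_Normal_Form.Determinant"
begin

section \<open>The field of rational functions in the indeterminates $t^{q^r}$\<close>

text \<open>Polynomials over the rationals in the commuting indeterminates \<open>t^(q^r)\<close>, one for each
  integer \<open>r\<close> (finitely supported exponents), and their field of fractions.\<close>

type_synonym tpoly = "(int \<Rightarrow>\<^sub>0 nat) \<Rightarrow>\<^sub>0 rat"
type_synonym tfield = "tpoly fract"

definition tvar :: "int \<Rightarrow> tfield" where
  "tvar r = Fract (Poly_Mapping.single (Poly_Mapping.single r 1) 1) 1"

text \<open>Exponents \<open>f(q)\<close> are Laurent polynomials in the formal variable \<open>q\<close>, i.e. elements of the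
  group ring \<open>int \<Rightarrow>\<^sub>0 int\<close>, whose unit is \<open>q^0\<close>.\<close>

definition qexp :: "nat \<Rightarrow> (int \<Rightarrow>\<^sub>0 int)" where
  "qexp r = Poly_Mapping.single (int r) 1"

definition tpow :: "(int \<Rightarrow>\<^sub>0 int) \<Rightarrow> tfield" where
  "tpow f = (\<Prod>r\<in>Poly_Mapping.keys f. tvar r powi Poly_Mapping.lookup f r)"

text \<open>Re-indexing the indeterminates by \<open>r \<mapsto> r + 1\<close>. Since \<open>map_key f p\<close> has coefficient function
  \<open>lookup p \<circ> f\<close>, monomials are moved by \<open>r \<mapsto> r - 1\<close>, and the polynomial by the inverse of that.\<close>

definition shift_mon :: "(int \<Rightarrow>\<^sub>0 nat) \<Rightarrow> (int \<Rightarrow>\<^sub>0 nat)" where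
  "shift_mon m = Poly_Mapping.map_key (\<lambda>r. r - 1) m"

definition unshift_mon :: "(int \<Rightarrow>\<^sub>0 nat) \<Rightarrow> (int \<Rightarrow>\<^sub>0 nat)" where
  "unshift_mon m = Poly_Mapping.map_key (\<lambda>r. r + 1) m"

definition shift_poly :: "tpoly \<Rightarrow> tpoly" where
  "shift_poly p = Poly_Mapping.map_key unshift_mon p"

lemma inj_minus1: "inj (\<lambda>r::int. r - 1)" and inj_plus1: "inj (\<lambda>r::int. r + 1)"
  by (auto simp: inj_def)

lemma unshift_shift [simp]: "unshift_mon (shift_mon m) = m"
  unfolding unshift_mon_def shift_mon_def
  by (rule poly_mapping_eqI) (simp add: map_key.rep_eq inj_minus1 inj_plus1)

lemma shift_unshift [simp]: "shift_mon (unshift_mon m) = m"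
  unfolding unshift_mon_def shift_mon_def
  by (rule poly_mapping_eqI) (simp add: map_key.rep_eq inj_minus1 inj_plus1)

lemma inj_unshift: "inj unshift_mon"
  by (metis injI shift_unshift)

lemma shift_mon_add: "shift_mon (m + m') = shift_mon m + shift_mon m'"
  unfolding shift_mon_def by (rule map_key_plus[OF inj_minus1])

lemma shift_mon_zero [simp]: "shift_mon 0 = 0"
  unfolding shift_mon_def by (rule map_key_zero[OF inj_minus1])

lemma shift_mon_single: "shift_mon (Poly_Mapping.single r c) = Poly_Mapping.single (r + 1) c"
  using map_key_single[OF inj_minus1, of "r + 1" c] unfolding shift_mon_def by simp

lemma shift_poly_single:
  "shift_poly (Poly_Mapping.single m c) = Poly_Mapping.single (shift_mon m) c"
  using map_key_single[OF inj_unshift, of "shift_mon m" c] unfolding shift_poly_def by simp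

lemma shift_poly_add: "shift_poly (p + p') = shift_poly p + shift_poly p'"
  unfolding shift_poly_def by (rule map_key_plus[OF inj_unshift])

lemma shift_poly_0 [simp]: "shift_poly 0 = 0"
  unfolding shift_poly_def by (rule map_key_zero[OF inj_unshift])

lemma shift_poly_1 [simp]: "shift_poly 1 = 1"
  unfolding single_one[symmetric] shift_poly_single by simp

lemma tpoly_induct:
  fixes p :: tpoly
  assumes "P 0"
    and "\<And>m c. P (Poly_Mapping.single m c)" and "\<And>p p'. P p \<Longrightarrow> P p' \<Longrightarrow> P (p + p')"
  shows "P p"
proof (induction p rule: update_induct)
  case (update f a b)
  then have "Poly_Mapping.update a b f = f + Poly_Mapping.single a b"
    by (intro poly_mapping_eqI) (auto simp: lookup_update lookup_add lookup_single in_keys_iff)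
  then show ?case using update assms by simp
qed (rule assms)

lemma shift_poly_mult: "shift_poly (p * p') = shift_poly p * shift_poly p'"
proof (induction p rule: tpoly_induct)
  case (2 m c)
  show ?case
  proof (induction p' rule: tpoly_induct)
    case (2 m' c')
    show ?case by (simp add: mult_single shift_poly_single shift_mon_add)
  qed (simp_all add: shift_poly_add distrib_left)
qed (simp_all add: shift_poly_add distrib_right)

lemma shift_poly_eq_0_iff [simp]: "shift_poly p = 0 \<longleftrightarrow> p = 0"
proof
  assume *: "shift_poly p = 0"
  show "p = 0"
  proof (rule poly_mapping_eqI)
    fix m
    have "Poly_Mapping.lookup (shift_poly p) (shift_mon m) = 0" using * by simp
    then show "Poly_Mapping.lookup p m = Poly_Mapping.lookup 0 m"
      unfolding shift_poly_def by (simp add: map_key.rep_eq[OF inj_unshift])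
  qed
qed simp

definition phi :: "tfield \<Rightarrow> tfield" where
  "phi x = (THE y. \<exists>a b. b \<noteq> 0 \<and> x = Fract a b \<and> y = Fract (shift_poly a) (shift_poly b))"

lemma phi_Fract: "b \<noteq> 0 \<Longrightarrow> phi (Fract a b) = Fract (shift_poly a) (shift_poly b)"
  unfolding phi_def by (rule the_equality) (auto simp: eq_fract simp flip: shift_poly_mult)

lemma phi_tvar: "phi (tvar r) = tvar (r + 1)"
  by (simp add: tvar_def phi_Fract shift_poly_single shift_mon_single)

lemma phi_1: "phi 1 = 1"
  by (simp add: One_fract_def phi_Fract)

lemma phi_add: "phi (x + y) = phi x + phi y"
  by (cases x; cases y) (simp add: phi_Fract shift_poly_add shift_poly_mult)

lemma phi_mult: "phi (x * y) = phi x * phi y"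
  by (cases x; cases y) (simp add: phi_Fract shift_poly_mult)

lemma surj_shift_poly: "surj shift_poly"
proof (rule surjI)
  fix p
  have *: "inj shift_mon" by (metis injI unshift_shift)
  show "shift_poly (Poly_Mapping.map_key shift_mon p) = p"
    unfolding shift_poly_def
    by (rule poly_mapping_eqI) (simp add: map_key.rep_eq * inj_unshift)
qed

lemma bij_phi: "bij phi"
proof (rule bijI)
  show "inj phi"
  proof (rule injI)
    fix x y assume "phi x = phi y"
    moreover have "phi (x - y) + phi y = phi x" by (simp flip: phi_add)
    ultimately have *: "phi (x - y) = 0" by simp
    show "x = y"
    proof (rule ccontr)
      assume "x \<noteq> y"
      then have "phi ((x - y) * inverse (x - y)) = 1" by (simp add: phi_1)
      with * show False by (simp add: phi_mult)
    qed
  qed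
  show "surj phi"
  proof (rule surjI)
    fix x :: tfield
    show "phi (SOME y. phi y = x) = x"
    proof (cases x)
      case (Fract a b)
      obtain a' b' where "a = shift_poly a'" "b = shift_poly b'"
        using surj_shift_poly by (metis surjD)
      then have "phi (Fract a' b') = x" using Fract by (auto simp: phi_Fract)
      then show ?thesis by (rule someI)
    qed
  qed
qed

section \<open>Factorials and multinomial coefficients\<close>

definition qvar :: "rat poly fract" where
  "qvar = Fract [:0, 1:] 1"

definition q_fact :: "nat \<Rightarrow> rat poly fract" where
  "q_fact m = (\<Prod>j=1..m. \<Sum>i<j. qvar ^ i)"

definition qt_fact :: "nat \<Rightarrow> tfield" where
  "qt_fact n = (\<Prod>i<n. 1 - tpow (qexp n - qexp i))"

text \<open>Reciprocals of factorials of negative integers are zero.\<close>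

definition recip_fact :: "(nat \<Rightarrow> 'a::field) \<Rightarrow> int \<Rightarrow> 'a" where
  "recip_fact F m = (if m < 0 then 0 else 1 / F (nat m))"

definition partial_sum :: "nat list \<Rightarrow> nat \<Rightarrow> nat" where
  "partial_sum \<alpha> i = sum_list (take i \<alpha>)"

definition multinom :: "nat \<Rightarrow> nat list \<Rightarrow> rat" where
  "multinom n \<beta> = fact n / (\<Prod>s<length \<beta>. fact (\<beta> ! s))"

definition q_multinom :: "nat \<Rightarrow> nat list \<Rightarrow> rat poly fract" where
  "q_multinom n \<beta> = q_fact n / (\<Prod>s<length \<beta>. q_fact (\<beta> ! s))"

definition qt_multinom :: "nat \<Rightarrow> nat list \<Rightarrow> tfield" where
  "qt_multinom n \<beta> =
     qt_fact n / (\<Prod>s<length \<beta>. (phi ^^ partial_sum \<beta> s) (qt_fact (\<beta> ! s)))"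

section \<open>Compositions and descent compositions\<close>

definition composition_of :: "nat \<Rightarrow> nat list \<Rightarrow> bool" where
  "composition_of n \<alpha> \<longleftrightarrow> (\<forall>a\<in>set \<alpha>. a > 0) \<and> sum_list \<alpha> = n"

definition refined_by :: "nat list \<Rightarrow> nat list \<Rightarrow> bool" where
  "refined_by \<beta> \<alpha> \<longleftrightarrow>
     partial_sum \<beta> ` {0..length \<beta>} \<subseteq> partial_sum \<alpha> ` {0..length \<alpha>}"

lemma finite_compositions: "finite {\<beta>. composition_of n \<beta>}"
proof (rule finite_subset)
  have "length \<beta> \<le> sum_list \<beta>" if "\<forall>a\<in>set \<beta>. a > 0" for \<beta> :: "nat list"
    using that by (induction \<beta>) auto
  then show "{\<beta>. composition_of n \<beta>} \<subseteq> {\<beta>. set \<beta> \<subseteq> {..n} \<and> length \<beta> \<le> n}"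
    by (auto simp: composition_of_def dest: member_le_sum_list)
qed (rule finite_lists_length_le, simp)

fun increasing_runs :: "nat list \<Rightarrow> nat list list" where
  "increasing_runs [] = []"
| "increasing_runs [x] = [[x]]"
| "increasing_runs (x # y # ys) =
     (let rs = increasing_runs (y # ys)
      in if x < y then (x # hd rs) # tl rs else [x] # rs)"

definition descent_comp :: "nat \<Rightarrow> (nat \<Rightarrow> nat) \<Rightarrow> nat list" where
  "descent_comp n w = map length (increasing_runs (map w [1..<Suc n]))"

definition inversions :: "nat \<Rightarrow> (nat \<Rightarrow> nat) \<Rightarrow> nat" where
  "inversions n w = card {(i, j). 1 \<le> i \<and> i < j \<and> j \<le> n \<and> w j < w i}"

section \<open>The weight of a permutation\<close>

text \<open>Partitions inside a \<open>k \<times> m\<close> rectangle are padded with zeros to length exactly \<open>k\<close>.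
  The part $\lambda_i$ is \<open>lam ! (i - 1)\<close>.\<close>

definition in_rectangle :: "nat \<Rightarrow> nat \<Rightarrow> nat list \<Rightarrow> bool" where
  "in_rectangle k m lam \<longleftrightarrow> length lam = k \<and> sorted_wrt (\<ge>) lam \<and> (\<forall>x\<in>set lam. x \<le> m)"

definition is_grassmann :: "nat \<Rightarrow> nat list \<Rightarrow> (nat \<Rightarrow> nat) \<Rightarrow> bool" where
  "is_grassmann n lam u \<longleftrightarrow> (let k = length lam in
     u permutes {1..n} \<and> strict_mono_on {1..k} u \<and> strict_mono_on {k+1..n} u \<and>
     (\<forall>i\<in>{1..k}. u i = lam ! (k - i) + i))"

definition grassmann :: "nat \<Rightarrow> nat list \<Rightarrow> (nat \<Rightarrow> nat)" where
  "grassmann n lam = (THE u. is_grassmann n lam u)"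

lemma strict_mono_on_image_unique:
  fixes f g :: "nat \<Rightarrow> nat"
  assumes "strict_mono_on {a..b} f" "strict_mono_on {a..b} g" "f ` {a..b} = g ` {a..b}"
    and "i \<in> {a..b}"
  shows "f i = g i"
proof -
  have *: "sorted (map h [a..<Suc b]) \<and> distinct (map h [a..<Suc b])"
    if "strict_mono_on {a..b} h" for h :: "nat \<Rightarrow> nat"
  proof -
    have "sorted_wrt (<) (map h [a..<Suc b])"
      unfolding sorted_wrt_iff_nth_less
    proof (intro allI impI)
      fix i j assume "i < j" "j < length (map h [a..<Suc b])"
      then have "a + i \<in> {a..b}" "a + j \<in> {a..b}" "a + i < a + j"
        "i < Suc b - a" "j < Suc b - a" by (auto simp del: upt_Suc)
      then show "map h [a..<Suc b] ! i < map h [a..<Suc b] ! j"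
        using strict_mono_onD[OF that] by (simp del: upt_Suc)
    qed
    then show ?thesis by (simp add: strict_sorted_iff)
  qed
  have "map f [a..<Suc b] = map g [a..<Suc b]"
  proof (rule sorted_distinct_set_unique)
    show "set (map f [a..<Suc b]) = set (map g [a..<Suc b])"
      using assms(3) by (simp add: atLeastLessThanSuc_atLeastAtMost del: upt_Suc)
  qed (use *[OF assms(1)] *[OF assms(2)] in blast)+
  then show ?thesis using assms(4) by (simp del: upt_Suc)
qed

lemma strict_mono_on_gap:
  fixes f :: "nat \<Rightarrow> nat"
  assumes "strict_mono_on {a..b} f" "a \<le> i" "i \<le> j" "j \<le> b"
  shows "f i + (j - i) \<le> f j"
  using assms(3,4)
proof (induction j rule: dec_induct)
  case (step m)
  have "f m < f (Suc m)" using assms(1,2) step by (auto simp: strict_mono_on_def)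
  then show ?case using step by auto
qed simp

lemma ex_shuffle:
  fixes S :: "nat set"
  assumes "S \<subseteq> {1..n}" "card S = k"
  shows "\<exists>u. u permutes {1..n} \<and> strict_mono_on {1..k} u \<and> strict_mono_on {k+1..n} u \<and>
    u ` {1..k} = S"
proof -
  define T where "T = {1..n} - S"
  have fin: "finite S" "finite T" using assms finite_subset unfolding T_def by auto
  have cT: "card T = n - k" using assms fin unfolding T_def by (simp add: card_Diff_subset)
  have kn: "k \<le> n" using assms card_mono[of "{1..n}" S] by simp
  define xs where "xs = sorted_list_of_set S"
  define ys where "ys = sorted_list_of_set T"
  have len: "length xs = k" "length ys = n - k" using assms cT by (simp_all add: xs_def ys_def)
  have st: "set xs = S" "set ys = T" using fin by (simp_all add: xs_def ys_def)
  have so: "sorted_wrt (<) xs" "sorted_wrt (<) ys" by (simp_all add: xs_def ys_def)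
  define u where "u i = (if i \<in> {1..n} then (xs @ ys) ! (i - 1) else i)" for i
  have ux: "u i = xs ! (i - 1)" if "i \<in> {1..k}" for i
    using that kn len by (auto simp: u_def nth_append)
  have uy: "u i = ys ! (i - 1 - k)" if "i \<in> {k+1..n}" for i
    using that kn len by (auto simp: u_def nth_append)
  have m1: "strict_mono_on {1..k} u"
  proof (rule strict_mono_onI)
    fix r s assume "r \<in> {1..k}" "s \<in> {1..k}" "r < s"
    then show "u r < u s" using sorted_wrt_nth_less[OF so(1), of "r - 1" "s - 1"] len
      by (simp add: ux)
  qed
  have m2: "strict_mono_on {k+1..n} u"
  proof (rule strict_mono_onI)
    fix r s assume "r \<in> {k+1..n}" "s \<in> {k+1..n}" "r < s"
    then show "u r < u s" using sorted_wrt_nth_less[OF so(2), of "r - 1 - k" "s - 1 - k"] len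
      by (subst (1 2) uy) auto
  qed
  have im1: "u ` {1..k} = S"
  proof -
    have "u ` {1..k} = (\<lambda>i. xs ! (i - 1)) ` {1..k}" using ux by auto
    also have "\<dots> = (!) xs ` ((\<lambda>i. i - 1) ` {1..k})" by (simp add: image_image)
    also have "(\<lambda>i. i - 1) ` {1..k} = {..<k}"
    proof -
      have "j \<in> (\<lambda>i. i - 1) ` {1..k}" if "j < k" for j
        using that by (intro image_eqI[of _ _ "Suc j"]) auto
      then show ?thesis by auto
    qed
    also have "(!) xs ` {..<k} = S" using len st by (auto simp: set_conv_nth)
    finally show ?thesis .
  qed
  have im2: "u ` {k+1..n} = T"
  proof -
    have "u ` {k+1..n} = (\<lambda>i. ys ! (i - 1 - k)) ` {k+1..n}" using uy by auto
    also have "\<dots> = (!) ys ` ((\<lambda>i. i - 1 - k) ` {k+1..n})" by (simp add: image_image)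
    also have "(\<lambda>i. i - 1 - k) ` {k+1..n} = {..<n-k}"
    proof -
      have "j \<in> (\<lambda>i. i - 1 - k) ` {k+1..n}" if "j < n - k" for j
        using that by (intro image_eqI[of _ _ "Suc (j + k)"]) auto
      then show ?thesis by auto
    qed
    also have "(!) ys ` {..<n-k} = T" using len st by (auto simp: set_conv_nth)
    finally show ?thesis .
  qed
  have "{1..n} = {1..k} \<union> {k+1..n}" using kn by auto
  then have im: "u ` {1..n} = {1..n}" using im1 im2 assms(1) by (auto simp: image_Un T_def)
  then have "bij_betw u {1..n} {1..n}"
    by (simp add: bij_betw_def eq_card_imp_inj_on)
  then have "u permutes {1..n}" by (rule bij_imp_permutes) (auto simp: u_def)
  with m1 m2 im1 show ?thesis by blast
qed

lemma shuffle_unique: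
  assumes "u permutes {1..n}" "strict_mono_on {1..k} u" "strict_mono_on {k+1..n} u"
    and "v permutes {1..n}" "strict_mono_on {1..k} v" "strict_mono_on {k+1..n} v"
    and "u ` {1..k} = v ` {1..k}" and "k \<le> (n::nat)"
  shows "u = v"
proof
  fix i
  have *: "p ` {k+1..n} = {1..n} - p ` {1..k}" if "p permutes {1..n}" for p :: "nat \<Rightarrow> nat"
  proof -
    have "{k+1..n} = {1..n} - {1..k}" by auto
    then show ?thesis
      using permutes_image[OF that] permutes_inj[OF that] by (simp add: image_set_diff)
  qed
  have "u ` {k+1..n} = v ` {k+1..n}" using * assms(1,4,7) by simp
  then have "u i = v i" if "i \<in> {k+1..n}"
    using strict_mono_on_image_unique[OF assms(3,6)] that by blast
  moreover have "u i = v i" if "i \<in> {1..k}"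
    using strict_mono_on_image_unique[OF assms(2,5,7)] that by blast
  moreover have "u i = v i" if "i \<notin> {1..n}"
    using assms(1,4) that by (simp add: permutes_not_in)
  ultimately show "u i = v i" by (cases "i \<in> {1..k}"; cases "i \<in> {1..n}") auto
qed

lemma ex1_is_grassmann:
  assumes "in_rectangle k (n - k) lam" "k \<le> n"
  shows "\<exists>!u. is_grassmann n lam u"
proof -
  have len: "length lam = k" and so: "sorted_wrt (\<ge>) lam" and bd: "\<forall>x\<in>set lam. x \<le> n - k"
    using assms(1) by (auto simp: in_rectangle_def)
  define f where "f i = lam ! (k - i) + i" for i
  have f: "strict_mono_on {1..k} f"
  proof (rule strict_mono_onI)
    fix r s assume rs: "r \<in> {1..k}" "s \<in> {1..k}" "r < s"
    then have "lam ! (k - r) \<le> lam ! (k - s)"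
      using sorted_wrt_nth_less[OF so, of "k - s" "k - r"] len by auto
    then show "f r < f s" using rs by (simp add: f_def)
  qed
  have "f ` {1..k} \<subseteq> {1..n}"
  proof
    fix x assume "x \<in> f ` {1..k}"
    then obtain i where i: "i \<in> {1..k}" "x = f i" by blast
    then have "lam ! (k - i) \<le> n - k" using bd len by (auto intro!: nth_mem)
    then show "x \<in> {1..n}" using i assms(2) by (auto simp: f_def)
  qed
  moreover have "card (f ` {1..k}) = k"
    using card_image[OF strict_mono_on_imp_inj_on[OF f]] by simp
  ultimately obtain u where u: "u permutes {1..n}" "strict_mono_on {1..k} u"
      "strict_mono_on {k+1..n} u" "u ` {1..k} = f ` {1..k}"
    using ex_shuffle by blast
  have "u i = f i" if "i \<in> {1..k}" for i
    using strict_mono_on_image_unique[OF u(2) f u(4)] that by blast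
  then have "is_grassmann n lam u" using u len by (simp add: is_grassmann_def f_def)
  moreover have "v = w" if "is_grassmann n lam v" "is_grassmann n lam w" for v w
  proof -
    have v: "v permutes {1..n}" "strict_mono_on {1..k} v" "strict_mono_on {k+1..n} v"
        "\<And>i. i \<in> {1..k} \<Longrightarrow> v i = f i"
      and w: "w permutes {1..n}" "strict_mono_on {1..k} w" "strict_mono_on {k+1..n} w"
        "\<And>i. i \<in> {1..k} \<Longrightarrow> w i = f i"
      using that len by (auto simp: is_grassmann_def f_def Let_def)
    have "v ` {1..k} = w ` {1..k}" using v(4) w(4) by (intro image_cong) auto
    then show "v = w"
      using shuffle_unique[OF v(1-3) w(1-3)] assms(2) by blast
  qed
  ultimately show ?thesis by blast
qed

lemma is_grassmann_grassmann:
  "in_rectangle k (n - k) lam \<Longrightarrow> k \<le> n \<Longrightarrow> is_grassmann n lam (grassmann n lam)"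
  unfolding grassmann_def by (rule theI'[of "is_grassmann n lam"]) (rule ex1_is_grassmann)

definition is_factorization ::
    "nat \<Rightarrow> (nat \<Rightarrow> nat) \<Rightarrow> nat list \<Rightarrow> (nat \<Rightarrow> nat) \<Rightarrow> (nat \<Rightarrow> nat) \<Rightarrow> bool" where
  "is_factorization n w lam a b \<longleftrightarrow> (let k = Hilbert_Choice.inv w 1 - 1 in
     in_rectangle k (n - k) lam \<and> a permutes {1..k} \<and> b permutes {k+2..n} \<and>
     w = grassmann n lam \<circ> a \<circ> b)"

lemma ex1_is_factorization:
  assumes w: "w permutes {1..n}" and n: "n \<ge> 1"
  shows "\<exists>!(lam, a, b). is_factorization n w lam a b"
proof -
  define k where "k = Hilbert_Choice.inv w 1 - 1"
  have fact_iff: "is_factorization n w lam a b \<longleftrightarrow>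
      in_rectangle k (n - k) lam \<and> a permutes {1..k} \<and> b permutes {k+2..n} \<and>
      w = grassmann n lam \<circ> a \<circ> b" for lam a b
    unfolding is_factorization_def k_def Let_def ..
  have "Hilbert_Choice.inv w 1 \<in> {1..n}" using permutes_in_image[OF permutes_inv[OF w], of 1] n by simp
  then have kn: "k < n" and k1: "Hilbert_Choice.inv w 1 = k + 1" by (auto simp: k_def)
  have wk: "w (k + 1) = 1" using k1 permutes_inverses(1)[OF w, of 1] by simp
  have injw: "inj w" using w by (rule permutes_inj)
  have S: "w ` {1..k} \<subseteq> {1..n}" "card (w ` {1..k}) = k"
  proof -
    show "w ` {1..k} \<subseteq> {1..n}" using permutes_image[OF w] kn by (metis atLeastatMost_subset_iff
        image_mono less_imp_le order_refl)
    show "card (w ` {1..k}) = k" using card_image[of w "{1..k}"] injw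
      by (simp add: inj_on_subset)
  qed
  obtain u where u: "u permutes {1..n}" "strict_mono_on {1..k} u" "strict_mono_on {k+1..n} u"
      "u ` {1..k} = w ` {1..k}"
    using ex_shuffle[OF S] by blast
  have gap: "u i + (j - i) \<le> u j" if "1 \<le> i" "i \<le> j" "j \<le> k" for i j
    using strict_mono_on_gap[OF u(2)] that by blast
  have ur: "u i \<in> {1..n}" if "i \<in> {1..n}" for i using permutes_in_image[OF u(1)] that by blast
  have ge: "i \<le> u i" if "i \<in> {1..k}" for i
    using gap[of 1 i] ur[of 1] n that by auto
  define lam where "lam = map (\<lambda>j. u (k - j) - (k - j)) [0..<k]"
  have nth: "lam ! (k - i) + i = u i" if "i \<in> {1..k}" for i
    using that ge[OF that] by (auto simp: lam_def)
  have rect: "in_rectangle k (n - k) lam"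
    unfolding in_rectangle_def
  proof (intro conjI ballI)
    show "length lam = k" by (simp add: lam_def)
    show "sorted_wrt (\<ge>) lam"
      unfolding sorted_wrt_iff_nth_less
    proof (intro allI impI)
      fix i j assume "i < j" "j < length lam"
      then have "i < k" "j < k" "i < j" by (auto simp: lam_def)
      moreover from this have "u (k - j) + (j - i) \<le> u (k - i)" "k - j \<le> u (k - j)"
        using gap[of "k - j" "k - i"] ge[of "k - j"] by auto
      ultimately have "u (k - j) - (k - j) \<le> u (k - i) - (k - i)" by linarith
      then show "lam ! j \<le> lam ! i"
        using \<open>i < k\<close> \<open>j < k\<close> by (simp add: lam_def)
    qed
    fix x assume "x \<in> set lam"
    then obtain j where "j < k" "x = u (k - j) - (k - j)" by (auto simp: lam_def)
    moreover from this have "u (k - j) + j \<le> u k" "u k \<le> n"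
      using gap[of "k - j" k] ur[of k] kn by auto
    ultimately show "x \<le> n - k" by linarith
  qed
  have gu: "is_grassmann n lam u"
    using u nth rect by (simp add: is_grassmann_def in_rectangle_def)
  then have g: "grassmann n lam = u"
    unfolding grassmann_def using ex1_is_grassmann[OF rect] kn by (intro the1_equality) auto
  have uk: "u (k + 1) = 1"
  proof -
    obtain j where j: "j \<in> {1..n}" "u j = 1"
      using permutes_image[OF u(1)] n by (metis atLeastAtMost_iff imageE order_refl)
    have "j \<notin> {1..k}"
    proof
      assume "j \<in> {1..k}"
      then have "1 \<in> w ` {1..k}" using u(4) j(2) by (metis imageI)
      then obtain x where "x \<in> {1..k}" "w x = w (k + 1)" using wk by auto
      then show False using injD[OF injw] by fastforce
    qed
    then have "u (k + 1) + (j - (k + 1)) \<le> u j"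
      using strict_mono_on_gap[OF u(3), of "k + 1" j] j by auto
    then show ?thesis using j ur[of "k + 1"] kn by auto
  qed
  define c where "c = Hilbert_Choice.inv u \<circ> w"
  have c: "c permutes {1..n}" unfolding c_def
    using permutes_compose[OF w permutes_inv[OF u(1)]] .
  have injc: "inj c" using c by (rule permutes_inj)
  have uc: "u \<circ> c = w"
    unfolding c_def using permutes_inv_o(1)[OF u(1)] by (simp add: o_assoc)
  have ck: "c (k + 1) = k + 1"
    unfolding c_def using wk uk permutes_inverses(2)[OF u(1), of "k + 1"] by simp
  have c1: "c ` {1..k} = {1..k}"
  proof -
    have "c ` {1..k} = Hilbert_Choice.inv u ` (u ` {1..k})" unfolding c_def using u(4) by (simp add: image_comp)
    then show ?thesis using permutes_inj[OF u(1)] by (simp add: image_image)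
  qed
  have c2: "c ` {k+2..n} = {k+2..n}"
  proof -
    have e: "{k+2..n} = {1..n} - ({1..k} \<union> {k+1})" by auto
    have "c ` {k+2..n} = c ` {1..n} - (c ` {1..k} \<union> c ` {k+1})"
      unfolding e using injc by (simp only: image_set_diff image_Un)
    then show ?thesis using permutes_image[OF c] c1 ck e by simp
  qed
  define a where "a i = (if i \<in> {1..k} then c i else i)" for i
  define b where "b i = (if i \<in> {k+2..n} then c i else i)" for i
  have a: "a permutes {1..k}"
  proof (rule bij_imp_permutes)
    show "bij_betw a {1..k} {1..k}"
      using c1 injc by (simp add: bij_betw_def a_def inj_on_def inj_def)
  qed (auto simp: a_def)
  have b: "b permutes {k+2..n}"
  proof (rule bij_imp_permutes)
    show "bij_betw b {k+2..n} {k+2..n}"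
      using c2 injc by (simp add: bij_betw_def b_def inj_on_def inj_def)
  qed (auto simp: b_def)
  have ab: "a \<circ> b = c"
  proof
    fix i
    consider "i \<in> {1..k}" | "i = k + 1" | "i \<in> {k+2..n}" | "i \<notin> {1..n}" by fastforce
    then show "(a \<circ> b) i = c i"
    proof cases
      case 3
      then have "c i \<in> {k+2..n}" using c2 by blast
      then show ?thesis using 3 by (auto simp: a_def b_def)
    next
      case 4
      then show ?thesis using permutes_not_in[OF c] kn by (auto simp: a_def b_def)
    qed (use ck in \<open>auto simp: a_def b_def\<close>)
  qed
  have "is_factorization n w lam a b"
    unfolding fact_iff using rect a b g ab uc by (simp only: o_assoc[symmetric])
  moreover have "lam1 = lam2 \<and> a1 = a2 \<and> b1 = b2"
    if "is_factorization n w lam1 a1 b1" "is_factorization n w lam2 a2 b2"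
    for lam1 a1 b1 lam2 a2 b2
  proof -
    have 1: "in_rectangle k (n - k) lam1" "a1 permutes {1..k}" "b1 permutes {k+2..n}"
        "w = grassmann n lam1 \<circ> a1 \<circ> b1"
      and 2: "in_rectangle k (n - k) lam2" "a2 permutes {1..k}" "b2 permutes {k+2..n}"
        "w = grassmann n lam2 \<circ> a2 \<circ> b2"
      using that unfolding fact_iff by blast+
    have im: "v ` {1..k} = w ` {1..k}"
      if "w = v \<circ> a' \<circ> b'" "a' permutes {1..k}" "b' permutes {k+2..n}" for v a' b'
    proof -
      have "w ` {1..k} = v ` a' ` b' ` {1..k}" using that(1) by (simp add: image_comp o_assoc)
      also have "b' ` {1..k} = {1..k}"
        using permutes_not_in[OF that(3)] by force
      also have "a' ` {1..k} = {1..k}" using that(2) by (rule permutes_image)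
      finally show ?thesis by simp
    qed
    define v1 where "v1 = grassmann n lam1"
    define v2 where "v2 = grassmann n lam2"
    have g1: "is_grassmann n lam1 v1" and g2: "is_grassmann n lam2 v2"
      unfolding v1_def v2_def using is_grassmann_grassmann 1 2 kn by simp_all
    have l: "length lam1 = k" "length lam2 = k" using 1 2 by (auto simp: in_rectangle_def)
    have v: "v1 = v2"
    proof (rule shuffle_unique[of _ n k])
      show "v1 ` {1..k} = v2 ` {1..k}" using im 1 2 unfolding v1_def v2_def by metis
    qed (use g1 g2 l kn in \<open>auto simp: is_grassmann_def Let_def\<close>)
    have "lam1 = lam2"
    proof (rule nth_equalityI)
      fix j assume "j < length lam1"
      then have j: "k - j \<in> {1..k}" "k - (k - j) = j" using l by auto
      then have "lam1 ! j + (k - j) = v1 (k - j)" "lam2 ! j + (k - j) = v2 (k - j)"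
        using g1 g2 l by (auto simp: is_grassmann_def Let_def)
      then show "lam1 ! j = lam2 ! j" using v by simp
    qed (use l in simp)
    have "inj v1" using g1 permutes_inj by (auto simp: is_grassmann_def Let_def)
    moreover have "v1 \<circ> (a1 \<circ> b1) = v1 \<circ> (a2 \<circ> b2)"
      using 1(4) 2(4) v unfolding v1_def v2_def by (simp add: o_assoc)
    ultimately have e: "a1 (b1 i) = a2 (b2 i)" for i
      by (metis comp_apply injD)
    have "a1 i = a2 i" for i
    proof (cases "i \<in> {1..k}")
      case True
      then show ?thesis using e[of i] permutes_not_in[OF 1(3)] permutes_not_in[OF 2(3)] by simp
    next
      case False
      then show ?thesis using permutes_not_in[OF 1(2)] permutes_not_in[OF 2(2)] by simp
    qed
    moreover have "b1 i = b2 i" for i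
      using e[of i] \<open>\<And>i. a1 i = a2 i\<close> permutes_inj[OF 1(2)] by (simp add: inj_def)
    ultimately show ?thesis using \<open>lam1 = lam2\<close> by auto
  qed
  ultimately show ?thesis by (intro ex1I[of _ "(lam, a, b)"]) auto
qed

text \<open>The identification of permutations of $\{d+1,\ldots,d+m\}$ with permutations of $\{1,\ldots,m\}$.\<close>

definition shift_perm :: "nat \<Rightarrow> (nat \<Rightarrow> nat) \<Rightarrow> (nat \<Rightarrow> nat)" where
  "shift_perm d b = (\<lambda>i. if i = 0 then 0 else b (i + d) - d)"

lemma shift_perm_permutes:
  assumes "b permutes {d+1..d+m}"
  shows "shift_perm d b permutes {1..m}"
proof (rule bij_imp_permutes)
  have r: "b (i + d) \<in> {d+1..d+m}" if "i \<in> {1..m}" for i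
    using permutes_in_image[OF assms, of "i + d"] that by auto
  have "inj_on (shift_perm d b) {1..m}"
  proof (rule inj_onI)
    fix i j assume ij: "i \<in> {1..m}" "j \<in> {1..m}" "shift_perm d b i = shift_perm d b j"
    then have "b (i + d) - d = b (j + d) - d" by (simp add: shift_perm_def)
    moreover have "d \<le> b (i + d)" "d \<le> b (j + d)" using r[OF ij(1)] r[OF ij(2)] by auto
    ultimately have "b (i + d) = b (j + d)" by linarith
    then show "i = j" using injD[OF permutes_inj[OF assms]] by fastforce
  qed
  moreover have "shift_perm d b ` {1..m} \<subseteq> {1..m}"
    using r by (fastforce simp: shift_perm_def)
  ultimately show "bij_betw (shift_perm d b) {1..m} {1..m}"
    by (simp add: bij_betw_def endo_inj_surj)
next
  fix i assume "i \<notin> {1..m}"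
  then show "shift_perm d b i = i"
    using permutes_not_in[OF assms, of "i + d"] by (auto simp: shift_perm_def)
qed

text \<open>Outside the permutations of $\{1,\ldots,n\}$ the value is a dummy, needed for termination.
  The identity factor \<open>e\<close> on $\{k+1\}$ is left implicit in the factorization.\<close>

function wt :: "nat \<Rightarrow> (nat \<Rightarrow> nat) \<Rightarrow> tfield" where
  "wt n w =
     (if n \<le> 1 \<or> \<not> w permutes {1..n} then 1
      else let k = Hilbert_Choice.inv w 1 - 1;
               (lam, a, b) = (THE (lam, a, b). is_factorization n w lam a b)
           in tpow (qexp k - 1) * (phi (qt_fact k) / qt_fact k) *
              phi (wt (n - 1) (grassmann (n - 1) (map (\<lambda>x. x - 1) lam))) *
              wt k a *
              (phi ^^ (k + 1)) (wt (n - k - 1) (shift_perm (k + 1) b)))"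
  by auto
termination
proof (relation "measure fst", goal_cases)
  case 1
  show ?case by simp
next
  case 2
  from 2(1) show ?case by simp
next
  case (3 n w k)
  from 3(1) have w: "w permutes {1..n}" and "1 \<in> {1..n}" by auto
  then have "Hilbert_Choice.inv w 1 \<in> {1..n}"
    using permutes_in_image[OF permutes_inv[OF w], of 1] by blast
  then have "Hilbert_Choice.inv w 1 - 1 < n" by (simp only: atLeastAtMost_iff) linarith
  with 3(2) show ?case by simp
next
  case 4
  from 4(1) show ?case by simp
qed

declare wt.simps [simp del]

section \<open>Ribbon numbers\<close>

definition ribbon_perms :: "nat list \<Rightarrow> (nat \<Rightarrow> nat) set" where
  "ribbon_perms \<alpha> =
     {w. w permutes {1..sum_list \<alpha>} \<and> descent_comp (sum_list \<alpha>) w = \<alpha>}"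

definition ribbon :: "nat list \<Rightarrow> nat" where
  "ribbon \<alpha> = card (ribbon_perms \<alpha>)"

definition q_ribbon :: "nat list \<Rightarrow> rat poly fract" where
  "q_ribbon \<alpha> = (\<Sum>w\<in>ribbon_perms \<alpha>. qvar ^ inversions (sum_list \<alpha>) w)"

definition qt_ribbon :: "nat list \<Rightarrow> tfield" where
  "qt_ribbon \<alpha> = (\<Sum>w\<in>ribbon_perms \<alpha>. wt (sum_list \<alpha>) w)"

end

theory Submission
  imports Defs
begin

text \<open>
  Let \<open>f(\<alpha>)\<close> be the sum of the weights of all permutations whose descents
  lie among the partial sums of \<open>\<alpha>\<close>. Grouping these permutations by their descent composition
  writes \<open>f(\<alpha>)\<close> as the sum of the ribbon numbers of all \<open>\<beta>\<close> refined by \<open>\<alpha>\<close>, so the alternating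
  sum is Moebius inversion (\<open>moebius_coarsenings\<close>) once \<open>f(\<alpha>)\<close> is known to be the multinomial
  coefficient. The determinant is the same alternating sum: its matrix has ones below the diagonal
  and zeros further down, so expanding along the first column either closes the first block of
  \<open>\<beta>\<close> or merges it with the next part of \<open>\<alpha>\<close> (\<open>det_partial_sums\<close>).

  The heart is thus the evaluation of \<open>f(\<alpha>)\<close> (\<open>subset_sum_eq\<close>), by induction on \<open>n\<close>, splitting
  by the position \<open>k + 1\<close> of the value 1. Removing this value is a bijection from the permutations
  with \<open>w(k+1) = 1\<close> to the triples \<open>(u, a, b)\<close> of a permutation \<open>u\<close> of \<open>n - 1\<close> elements with no
  descent except at \<open>k\<close>, a permutation \<open>a\<close> of the \<open>k\<close> positions to the left and a permutation \<open>b\<close>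
  of those to the right (\<open>bij_betw_glue\<close>). Descents and weight both split along it: unless
  \<open>k = 0\<close> there is a descent at \<open>k\<close>, so \<open>k\<close> must be a partial sum of \<open>\<alpha>\<close>, and the other descents
  are those of \<open>a\<close> and \<open>b\<close>. The sums over \<open>u\<close>, \<open>a\<close> and \<open>b\<close> are instances of the same problem, so by
  induction each admissible \<open>k\<close>, with \<open>k + d + 1\<close> the next partial sum, contributes
  \[ c_k\,\frac{\varphi((n-1)!)}{\prod_s \varphi^{\sigma_{s-1}}(\alpha_s!)}\cdot
     \frac{\varphi^k((d+1)!)}{\varphi^{k+1}(d!)} . \]
  What makes these terms add up is that \<open>c\<^sub>k\<close> times the last fraction is a difference
  \<open>\<psi>(k + d + 1) - \<psi>(k)\<close> (\<open>1 - t\<^sub>m / t\<^sub>0\<close> for \<open>\<psi>(m)\<close> in the \<open>(q, t)\<close> case, where \<open>t\<^sub>m\<close> stands for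
  the indeterminate with exponent \<open>q\<^sup>m\<close>; the \<open>q\<close>-integer of \<open>m\<close> in the \<open>q\<close> case; \<open>m\<close> itself for
  plain counting). The sum telescopes to \<open>\<psi>(n)\<close>, and \<open>\<psi>(n) \<phi>((n-1)!) = n!\<close>. The locale
  \<open>ribbon_weight\<close> records exactly these properties, and the three claims are its three instances.
\<close>

section \<open>Compositions and their coarsenings\<close>

definition psums :: "nat list \<Rightarrow> nat set" where
  "psums \<alpha> = partial_sum \<alpha> ` {0..length \<alpha>}"

lemma refined_by_psums: "refined_by \<beta> \<alpha> \<longleftrightarrow> psums \<beta> \<subseteq> psums \<alpha>"
  by (simp add: refined_by_def psums_def)

lemma partial_sum_0 [simp]: "partial_sum \<alpha> 0 = 0"
  by (simp add: partial_sum_def)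

lemma partial_sum_Cons_Suc [simp]: "partial_sum (a # \<alpha>) (Suc i) = a + partial_sum \<alpha> i"
  by (simp add: partial_sum_def)

lemma psums_Nil [simp]: "psums [] = {0}"
  by (simp add: psums_def)

lemma psums_Cons [simp]: "psums (a # \<alpha>) = insert 0 ((+) a ` psums \<alpha>)"
proof -
  have "{0..length (a # \<alpha>)} = insert 0 (Suc ` {0..length \<alpha>})"
    by (auto simp: image_iff Bex_def)
  then show ?thesis unfolding psums_def by (simp only: image_insert image_image) simp
qed

lemma zero_in_psums [simp]: "0 \<in> psums \<alpha>"
  by (cases \<alpha>) auto

lemma psums_append: "psums (\<alpha> @ \<beta>) = psums \<alpha> \<union> (+) (sum_list \<alpha>) ` psums \<beta>"
  by (induction \<alpha>) (auto simp: image_Un image_image add.assoc insert_absorb)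

lemma psums_le: "x \<in> psums \<alpha> \<Longrightarrow> x \<le> sum_list \<alpha>"
  by (induction \<alpha> arbitrary: x) auto

lemma sum_list_in_psums: "sum_list \<alpha> \<in> psums \<alpha>"
  by (induction \<alpha>) auto

text \<open>This recursion on the first two parts, kept apart or merged, is the one that
  the Moebius inversion and the determinant follow.\<close>

fun coarsenings :: "nat list \<Rightarrow> nat list set" where
  "coarsenings [] = {[]}"
| "coarsenings [a] = {[a]}"
| "coarsenings (a # b # \<alpha>) = (#) a ` coarsenings (b # \<alpha>) \<union> coarsenings ((a + b) # \<alpha>)"

lemma coarsenings_Nil_iff: "\<beta> \<in> coarsenings \<alpha> \<Longrightarrow> \<beta> = [] \<longleftrightarrow> \<alpha> = []"
  by (induction \<alpha> arbitrary: \<beta> rule: coarsenings.induct) auto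

lemma hd_coarsenings: "\<beta> \<in> coarsenings (a # \<alpha>) \<Longrightarrow> a \<le> hd \<beta>"
  by (induction "a # \<alpha>" arbitrary: a \<alpha> \<beta> rule: coarsenings.induct) fastforce+

lemma length_coarsenings: "\<beta> \<in> coarsenings \<alpha> \<Longrightarrow> length \<beta> \<le> length \<alpha>"
  by (induction \<alpha> arbitrary: \<beta> rule: coarsenings.induct) fastforce+

lemma finite_coarsenings [simp]: "finite (coarsenings \<alpha>)"
  by (induction \<alpha> rule: coarsenings.induct) auto

lemma coarsenings_iff:
  assumes "\<forall>a\<in>set \<alpha>. a > 0"
  shows "\<beta> \<in> coarsenings \<alpha> \<longleftrightarrow> composition_of (sum_list \<alpha>) \<beta> \<and> refined_by \<beta> \<alpha>"
  using assms
proof (induction \<alpha> arbitrary: \<beta> rule: coarsenings.induct)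
  case 1
  have "\<beta> = []" if "composition_of 0 \<beta>"
    using that by (cases \<beta>) (auto simp: composition_of_def)
  then show ?case by (auto simp: composition_of_def refined_by_psums)
next
  case (2 a)
  have "\<beta> = [a]" if c: "composition_of a \<beta>" and r: "psums \<beta> \<subseteq> psums [a]"
  proof (cases \<beta>)
    case Nil
    then show ?thesis using c 2 by (simp add: composition_of_def)
  next
    case (Cons x \<beta>')
    then have "x \<in> psums \<beta>" "x > 0" using c by (auto simp: composition_of_def)
    then have "x = a" using r by auto
    then show ?thesis using c Cons by (cases \<beta>') (auto simp: composition_of_def)
  qed
  then show ?case using 2 by (auto simp: composition_of_def refined_by_psums)
next
  case (3 a b \<alpha>)
  then have pos: "a > 0" "b > 0" "\<forall>a\<in>set \<alpha>. a > 0" by auto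
  have IH1: "\<beta> \<in> coarsenings (b # \<alpha>) \<longleftrightarrow>
      composition_of (sum_list (b # \<alpha>)) \<beta> \<and> psums \<beta> \<subseteq> psums (b # \<alpha>)" for \<beta>
    using 3 by (simp add: refined_by_psums)
  have IH2: "\<beta> \<in> coarsenings ((a + b) # \<alpha>) \<longleftrightarrow>
      composition_of (sum_list ((a + b) # \<alpha>)) \<beta> \<and> psums \<beta> \<subseteq> psums ((a + b) # \<alpha>)" for \<beta>
    using 3 by (simp add: refined_by_psums)
  have big: "psums (a # b # \<alpha>) = {0, a} \<union> psums ((a + b) # \<alpha>)"
    by (auto simp: image_image add.assoc)
  show ?case
  proof
    assume "\<beta> \<in> coarsenings (a # b # \<alpha>)"
    then show "composition_of (sum_list (a # b # \<alpha>)) \<beta> \<and> refined_by \<beta> (a # b # \<alpha>)"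
      unfolding coarsenings.simps
    proof
      assume "\<beta> \<in> (#) a ` coarsenings (b # \<alpha>)"
      then show ?thesis using IH1 pos
        by (auto simp: composition_of_def refined_by_psums simp del: psums_Cons(1))
          (auto simp del: coarsenings.simps)
    next
      assume "\<beta> \<in> coarsenings ((a + b) # \<alpha>)"
      then show ?thesis unfolding IH2 refined_by_psums big by (auto simp: add.assoc)
    qed
  next
    assume *: "composition_of (sum_list (a # b # \<alpha>)) \<beta> \<and> refined_by \<beta> (a # b # \<alpha>)"
    then have sub: "psums \<beta> \<subseteq> psums (a # b # \<alpha>)" by (simp add: refined_by_psums)
    have "\<beta> \<noteq> []" using * pos by (auto simp: composition_of_def)
    then obtain x \<beta>' where \<beta>: "\<beta> = x # \<beta>'" by (cases \<beta>) auto
    have x0: "x > 0" using * \<beta> by (auto simp: composition_of_def)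
    have "x \<in> psums \<beta>" using \<beta> by auto
    then have "x \<in> psums (a # b # \<alpha>)" using sub by blast
    then consider "x = a" | "x \<ge> a + b" using x0 by (auto simp: image_image)
    then show "\<beta> \<in> coarsenings (a # b # \<alpha>)"
    proof cases
      case 1
      have "(+) a ` psums \<beta>' \<subseteq> insert 0 ((+) a ` psums (b # \<alpha>))"
        using sub \<beta> 1 unfolding psums_Cons[of a] by auto
      then have "psums \<beta>' \<subseteq> psums (b # \<alpha>)" using pos(1) by auto
      moreover have "composition_of (sum_list (b # \<alpha>)) \<beta>'"
        using * \<beta> 1 by (auto simp: composition_of_def)
      ultimately have "\<beta>' \<in> coarsenings (b # \<alpha>)" using IH1 by blast
      then show ?thesis using \<beta> 1 by simp
    next
      case 2
      then have "a \<notin> psums \<beta>" using \<beta> pos by auto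
      then have "psums \<beta> \<subseteq> psums ((a + b) # \<alpha>)" using sub unfolding big by auto
      then have "\<beta> \<in> coarsenings ((a + b) # \<alpha>)"
        unfolding IH2 using * by (simp add: add.assoc)
      then show ?thesis by simp
    qed
  qed
qed

lemma composition_coarsenings:
  assumes "composition_of n \<alpha>"
  shows "{\<beta>. composition_of n \<beta> \<and> refined_by \<beta> \<alpha>} = coarsenings \<alpha>"
  using assms coarsenings_iff[of \<alpha>] by (auto simp: composition_of_def)

lemma sum_coarsenings_Cons_Cons:
  assumes "b > 0"
  shows "(\<Sum>\<beta>\<in>coarsenings (a # b # \<alpha>). G \<beta>) =
    (\<Sum>\<beta>\<in>coarsenings (b # \<alpha>). G (a # \<beta>)) + (\<Sum>\<beta>\<in>coarsenings ((a + b) # \<alpha>). G \<beta>)"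
proof -
  have "(#) a ` coarsenings (b # \<alpha>) \<inter> coarsenings ((a + b) # \<alpha>) = {}"
    using hd_coarsenings[of _ "a + b" \<alpha>] assms by fastforce
  then show ?thesis by (simp add: sum.union_disjoint sum.reindex)
qed

fun add_hd :: "nat \<Rightarrow> nat list \<Rightarrow> nat list" where
  "add_hd a [] = []"
| "add_hd a (b # \<alpha>) = (a + b) # \<alpha>"

lemma coarsenings_add_hd: "coarsenings (add_hd a \<alpha>) = add_hd a ` coarsenings \<alpha>"
  by (induction \<alpha> rule: coarsenings.induct) (auto simp: image_Un image_image add.assoc)

lemma inj_on_add_hd: "inj_on (add_hd a) S"
proof (rule inj_onI)
  fix x y assume "add_hd a x = add_hd a y"
  then show "x = y" by (cases x; cases y) auto
qed

lemma coarsenings_pos: "\<lbrakk>\<beta> \<in> coarsenings \<alpha>; \<forall>a\<in>set \<alpha>. a > 0\<rbrakk> \<Longrightarrow> \<forall>b\<in>set \<beta>. b > 0"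
  using coarsenings_iff by (auto simp: composition_of_def)

text \<open>Keeping the first two parts of \<open>\<alpha>\<close> apart also produces compositions in which they get merged
  by the inner sum; the terms with a merge already in the outer sum have the opposite sign and
  cancel these. Both kinds are of the form \<open>add_hd a \<gamma>\<close>, which is why \<open>g\<close> has to vary in the
  induction.\<close>

lemma moebius_coarsenings:
  fixes g :: "nat list \<Rightarrow> 'a::comm_ring_1"
  assumes "\<forall>a\<in>set \<alpha>. a > 0"
  shows "(\<Sum>\<beta>\<in>coarsenings \<alpha>. (-1) ^ (length \<alpha> - length \<beta>) * (\<Sum>\<gamma>\<in>coarsenings \<beta>. g \<gamma>)) = g \<alpha>"
  using assms
proof (induction \<alpha> arbitrary: g rule: coarsenings.induct)
  case (3 a b \<alpha>)
  then have pos: "a > 0" "b > 0" "\<forall>c\<in>set (b # \<alpha>). c > 0" by auto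
  let ?G = "\<lambda>\<beta>. (\<Sum>\<gamma>\<in>coarsenings \<beta>. g \<gamma>)"
  have split: "?G (a # \<beta>) = (\<Sum>\<gamma>\<in>coarsenings \<beta>. g (a # \<gamma>)) + (\<Sum>\<gamma>\<in>coarsenings \<beta>. g (add_hd a \<gamma>))"
    if \<beta>: "\<beta> \<in> coarsenings (b # \<alpha>)" for \<beta>
  proof (cases \<beta>)
    case Nil
    then show ?thesis using coarsenings_Nil_iff[OF \<beta>] by simp
  next
    case (Cons c \<beta>')
    then have "c > 0" using coarsenings_pos[OF \<beta> pos(3)] by simp
    then have "?G (a # c # \<beta>') = (\<Sum>\<gamma>\<in>coarsenings (c # \<beta>'). g (a # \<gamma>)) + ?G (add_hd a (c # \<beta>'))"
      by (subst sum_coarsenings_Cons_Cons) auto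
    also have "?G (add_hd a (c # \<beta>')) = (\<Sum>\<gamma>\<in>coarsenings (c # \<beta>'). g (add_hd a \<gamma>))"
      unfolding coarsenings_add_hd by (simp add: sum.reindex[OF inj_on_add_hd])
    finally show ?thesis using Cons by simp
  qed
  have "(\<Sum>\<beta>\<in>coarsenings (a # b # \<alpha>). (-1) ^ (length (a # b # \<alpha>) - length \<beta>) * ?G \<beta>) =
      (\<Sum>\<beta>\<in>coarsenings (b # \<alpha>). (-1) ^ (length (b # \<alpha>) - length \<beta>) * ?G (a # \<beta>)) +
      (\<Sum>\<beta>\<in>coarsenings ((a + b) # \<alpha>). (-1) ^ (length (a # b # \<alpha>) - length \<beta>) * ?G \<beta>)"
    by (subst sum_coarsenings_Cons_Cons[OF pos(2)]) simp
  also have "(\<Sum>\<beta>\<in>coarsenings (b # \<alpha>). (-1) ^ (length (b # \<alpha>) - length \<beta>) * ?G (a # \<beta>)) =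
      (\<Sum>\<beta>\<in>coarsenings (b # \<alpha>). (-1) ^ (length (b # \<alpha>) - length \<beta>) *
        (\<Sum>\<gamma>\<in>coarsenings \<beta>. g (a # \<gamma>))) +
      (\<Sum>\<beta>\<in>coarsenings (b # \<alpha>). (-1) ^ (length (b # \<alpha>) - length \<beta>) *
        (\<Sum>\<gamma>\<in>coarsenings \<beta>. g (add_hd a \<gamma>)))"
    by (simp add: split distrib_left sum.distrib)
  also have "\<dots> = g (a # b # \<alpha>) + g ((a + b) # \<alpha>)"
    using "3.IH"(1)[OF pos(3), of "\<lambda>\<gamma>. g (a # \<gamma>)"] "3.IH"(1)[OF pos(3), of "\<lambda>\<gamma>. g (add_hd a \<gamma>)"]
    by simp
  also have "(\<Sum>\<beta>\<in>coarsenings ((a + b) # \<alpha>). (-1) ^ (length (a # b # \<alpha>) - length \<beta>) * ?G \<beta>) =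
      (\<Sum>\<beta>\<in>coarsenings ((a + b) # \<alpha>). - ((-1) ^ (length ((a + b) # \<alpha>) - length \<beta>) * ?G \<beta>))"
    using length_coarsenings[of _ "(a + b) # \<alpha>"] by (intro sum.cong) (auto simp: Suc_diff_le)
  also have "\<dots> = - g ((a + b) # \<alpha>)"
    unfolding sum_negf using "3.IH"(2)[of g] pos by simp
  finally show ?case by simp
qed auto

section \<open>The determinant\<close>

text \<open>The first column is \<open>h(p, p + a), 1, 0, ..., 0\<close>. Deleting it together with the first row leaves
  the matrix of \<open>b # \<alpha>\<close> with origin \<open>p + a\<close>; together with the second row, it leaves the matrix of
  \<open>(a + b) # \<alpha>\<close>.\<close>

lemma det_partial_sums:
  fixes h :: "nat \<Rightarrow> nat \<Rightarrow> 'a::comm_ring_1"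
  assumes one: "\<And>p. h p p = 1" and zero: "\<And>p r. r < p \<Longrightarrow> h p r = 0"
    and "\<forall>a\<in>set \<alpha>. a > 0"
  shows "det (mat (length \<alpha>) (length \<alpha>) (\<lambda>(i, j). h (p + partial_sum \<alpha> i) (p + partial_sum \<alpha> (j + 1)))) =
    (\<Sum>\<beta>\<in>coarsenings \<alpha>. (-1) ^ (length \<alpha> - length \<beta>) *
       (\<Prod>s<length \<beta>. h (p + partial_sum \<beta> s) (p + partial_sum \<beta> (s + 1))))"
  using assms(3)
proof (induction \<alpha> arbitrary: p rule: coarsenings.induct)
  case 1
  show ?case by simp
next
  case (2 a)
  then show ?case by (simp add: det_single)
next
  case (3 a b \<alpha>)
  let ?P = "\<lambda>p \<beta>. \<Prod>s<length \<beta>. h (p + partial_sum \<beta> s) (p + partial_sum \<beta> (s + 1))"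
  let ?M = "\<lambda>p \<alpha>. mat (length \<alpha>) (length \<alpha>) (\<lambda>(i, j). h (p + partial_sum \<alpha> i) (p + partial_sum \<alpha> (j + 1)))"
  from 3 have pos: "a > 0" "b > 0" "\<forall>c\<in>set \<alpha>. c > 0" by auto
  define A where "A = ?M p (a # b # \<alpha>)"
  define n where "n = length \<alpha>"
  have A: "A \<in> carrier_mat (Suc (Suc n)) (Suc (Suc n))" by (simp add: A_def n_def)
  have A0: "A $$ (0, 0) = h p (p + a)" by (simp add: A_def)
  have A1: "A $$ (Suc 0, 0) = 1" by (simp add: A_def one)
  have A2: "A $$ (Suc (Suc i), 0) = 0" if "i < n" for i
    using that pos by (simp add: A_def n_def zero)
  have D0: "mat_delete A 0 0 = ?M (p + a) (b # \<alpha>)"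
    by (rule eq_matI) (auto simp: mat_delete_def A_def add.assoc)
  have D1: "mat_delete A (Suc 0) 0 = ?M p ((a + b) # \<alpha>)"
  proof (rule eq_matI)
    fix i j assume "i < dim_row (?M p ((a + b) # \<alpha>))" "j < dim_col (?M p ((a + b) # \<alpha>))"
    then show "mat_delete A (Suc 0) 0 $$ (i, j) = ?M p ((a + b) # \<alpha>) $$ (i, j)"
      by (cases i) (auto simp: mat_delete_def A_def add.assoc)
  qed (auto simp: A_def)
  have "det A = (\<Sum>i<Suc (Suc n). A $$ (i, 0) * cofactor A i 0)"
    by (rule laplace_expansion_column[OF A]) simp
  also have "\<dots> = h p (p + a) * det (?M (p + a) (b # \<alpha>)) - det (?M p ((a + b) # \<alpha>))"
    unfolding sum.lessThan_Suc_shift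
    by (simp add: A0 A1 A2 cofactor_def D0 D1 del: sum.lessThan_Suc)
  also have "det (?M (p + a) (b # \<alpha>)) =
      (\<Sum>\<beta>\<in>coarsenings (b # \<alpha>). (-1) ^ (length (b # \<alpha>) - length \<beta>) * ?P (p + a) \<beta>)"
    using pos by (intro "3.IH"(1)) auto
  also have "det (?M p ((a + b) # \<alpha>)) =
      (\<Sum>\<beta>\<in>coarsenings ((a + b) # \<alpha>). (-1) ^ (length ((a + b) # \<alpha>) - length \<beta>) * ?P p \<beta>)"
    using pos by (intro "3.IH"(2)) auto
  also have "h p (p + a) * (\<Sum>\<beta>\<in>coarsenings (b # \<alpha>). (-1) ^ (length (b # \<alpha>) - length \<beta>) * ?P (p + a) \<beta>)
      = (\<Sum>\<beta>\<in>coarsenings (b # \<alpha>). (-1) ^ (length (a # b # \<alpha>) - length (a # \<beta>)) * ?P p (a # \<beta>))"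
    unfolding sum_distrib_left
    by (intro sum.cong) (simp_all add: prod.lessThan_Suc_shift add.assoc mult_ac del: prod.lessThan_Suc)
  also have "(\<Sum>\<beta>\<in>coarsenings ((a + b) # \<alpha>). (-1) ^ (length ((a + b) # \<alpha>) - length \<beta>) * ?P p \<beta>) =
      - (\<Sum>\<beta>\<in>coarsenings ((a + b) # \<alpha>). (-1) ^ (length (a # b # \<alpha>) - length \<beta>) * ?P p \<beta>)"
    unfolding sum_negf[symmetric]
    using length_coarsenings[of _ "(a + b) # \<alpha>"] by (intro sum.cong) (auto simp: Suc_diff_le)
  finally show ?case
    unfolding A_def by (subst sum_coarsenings_Cons_Cons[OF pos(2)]) simp
qed

section \<open>Descents\<close>

definition descents :: "nat \<Rightarrow> (nat \<Rightarrow> nat) \<Rightarrow> nat set" where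
  "descents n w = {i. 1 \<le> i \<and> i < n \<and> w (Suc i) < w i}"

text \<open>Positions in a list count from 0, those of \<open>descents\<close> from 1.\<close>

definition list_descents :: "nat list \<Rightarrow> nat set" where
  "list_descents xs = {i. Suc i < length xs \<and> xs ! Suc i < xs ! i}"

lemma increasing_runs_Cons:
  "\<exists>r rs. increasing_runs (x # xs) = r # rs \<and> r \<noteq> []"
  by (induction xs arbitrary: x) (auto simp: Let_def, (metis list.sel(1) list.discI)?)

lemma list_descents_Cons_Cons:
  "list_descents (x # y # ys) = (if y < x then {0} else {}) \<union> Suc ` list_descents (y # ys)"
proof (rule Set.set_eqI)
  fix i show "i \<in> list_descents (x # y # ys) \<longleftrightarrow>
      i \<in> (if y < x then {0} else {}) \<union> Suc ` list_descents (y # ys)"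
    by (cases i) (auto simp: list_descents_def)
qed

text \<open>The descent composition of a word is determined by its partial sums, which are the descents
  together with the two end points.\<close>

lemma increasing_runs_props:
  assumes "distinct xs"
  shows "psums (map length (increasing_runs xs)) = {0, length xs} \<union> Suc ` list_descents xs"
    and "composition_of (length xs) (map length (increasing_runs xs))"
proof -
  have "psums (map length (increasing_runs xs)) = {0, length xs} \<union> Suc ` list_descents xs \<and>
    composition_of (length xs) (map length (increasing_runs xs))"
    using assms
  proof (induction xs rule: increasing_runs.induct)
    case 1
    show ?case by (simp add: list_descents_def composition_of_def)
  next
    case (2 x)
    show ?case by (simp add: list_descents_def composition_of_def)
  next
    case (3 x y ys)
    obtain r rs where r: "increasing_runs (y # ys) = r # rs" "r \<noteq> []"
      using increasing_runs_Cons by blast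
    obtain l where l: "length r = Suc l" using r(2) by (cases r) auto
    have IH: "psums (Suc l # map length rs) = {0, length (y # ys)} \<union> Suc ` list_descents (y # ys)"
      "composition_of (length (y # ys)) (Suc l # map length rs)"
      using 3 r l by auto
    show ?case
    proof (cases "x < y")
      case True
      have "(+) (Suc l) ` psums (map length rs) = {length (y # ys)} \<union> Suc ` list_descents (y # ys)"
        using IH(1) by (auto simp: set_eq_iff image_iff)
      then have "Suc ` (+) (Suc l) ` psums (map length rs) =
          Suc ` ({length (y # ys)} \<union> Suc ` list_descents (y # ys))" by (rule arg_cong)
      then show ?thesis using True r l IH(2)
        by (auto simp: composition_of_def list_descents_Cons_Cons image_image)
    next
      case False
      then have "y < x" using 3 by auto
      then show ?thesis using False r l IH
        by (auto simp: composition_of_def list_descents_Cons_Cons image_Un image_image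
            simp del: psums_Cons) (auto simp: psums_Cons[of 1] image_Un image_image)
    qed
  qed
  then show "psums (map length (increasing_runs xs)) = {0, length xs} \<union> Suc ` list_descents xs"
    and "composition_of (length xs) (map length (increasing_runs xs))" by blast+
qed

lemma descents_list: "descents n w = Suc ` list_descents (map w [1..<Suc n])"
proof (rule Set.set_eqI)
  fix i show "i \<in> descents n w \<longleftrightarrow> i \<in> Suc ` list_descents (map w [1..<Suc n])"
    by (cases i) (auto simp: descents_def list_descents_def simp del: upt_Suc)
qed

lemma descent_comp_props:
  assumes "w permutes {1..n}"
  shows psums_descent_comp: "psums (descent_comp n w) = {0, n} \<union> descents n w"
    and composition_descent_comp: "composition_of n (descent_comp n w)"
proof -
  have "distinct (map w [1..<Suc n])"
    using inj_on_subset[OF permutes_inj[OF assms]] by (simp add: distinct_map del: upt_Suc)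
  from increasing_runs_props[OF this]
  show "psums (descent_comp n w) = {0, n} \<union> descents n w"
    "composition_of n (descent_comp n w)"
    by (simp_all add: descent_comp_def descents_list del: upt_Suc)
qed

lemma descent_comp_in_coarsenings:
  assumes "w permutes {1..n}" "composition_of n \<alpha>"
  shows "descent_comp n w \<in> coarsenings \<alpha> \<longleftrightarrow> descents n w \<subseteq> psums \<alpha>"
  unfolding composition_coarsenings[OF assms(2), symmetric]
  using descent_comp_props[OF assms(1)] assms(2) sum_list_in_psums[of \<alpha>]
  by (auto simp: refined_by_psums composition_of_def)

section \<open>Removing the value 1\<close>

text \<open>The one-line word of \<open>u\<close> with all values increased by one and the value 1 inserted at position
  \<open>k + 1\<close>. The clause for 0 makes this a permutation of \<open>{1..n + 1}\<close> when \<open>u\<close> is one of \<open>{1..n}\<close>.\<close>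

definition lift :: "nat \<Rightarrow> (nat \<Rightarrow> nat) \<Rightarrow> nat \<Rightarrow> nat" where
  "lift k u i = (if i = 0 then 0 else if i = Suc k then 1
     else if i \<le> k then Suc (u i) else Suc (u (i - 1)))"

text \<open>The inverse of \<open>shift_perm\<close>.\<close>

definition unshift_perm :: "nat \<Rightarrow> (nat \<Rightarrow> nat) \<Rightarrow> nat \<Rightarrow> nat" where
  "unshift_perm d b i = (if i \<le> d then i else b (i - d) + d)"

text \<open>The permutation with 1 at position \<open>k + 1\<close> whose remaining values are distributed over the two
  sides as in \<open>u\<close>, and ordered on the left and on the right as in \<open>a\<close> and \<open>b\<close>.\<close>

definition glue :: "nat \<Rightarrow> (nat \<Rightarrow> nat) \<Rightarrow> (nat \<Rightarrow> nat) \<Rightarrow> (nat \<Rightarrow> nat) \<Rightarrow> nat \<Rightarrow> nat" where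
  "glue k u a b = lift k u \<circ> a \<circ> unshift_perm (Suc k) b"

definition grassmann_perms :: "nat \<Rightarrow> nat \<Rightarrow> (nat \<Rightarrow> nat) set" where
  "grassmann_perms k m = {u. u permutes {1..k + m} \<and> descents (k + m) u \<subseteq> {k}}"

lemma unshift_perm_permutes:
  assumes "b permutes {1..m}"
  shows "unshift_perm d b permutes {d+1..d+m}"
proof (rule bij_imp_permutes)
  have r: "b i \<in> {1..m}" if "i \<in> {1..m}" for i
    using permutes_in_image[OF assms, of i] that by auto
  have "inj_on (unshift_perm d b) {d+1..d+m}"
    using permutes_inj[OF assms]
    by (intro inj_onI) (simp add: unshift_perm_def inj_eq eq_diff_iff)
  moreover have "unshift_perm d b ` {d+1..d+m} \<subseteq> {d+1..d+m}"
  proof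
    fix y assume "y \<in> unshift_perm d b ` {d+1..d+m}"
    then obtain i where "i \<in> {d+1..d+m}" "y = unshift_perm d b i" by blast
    moreover from this have "i - d \<in> {1..m}" by auto
    ultimately show "y \<in> {d+1..d+m}" using r[of "i - d"] by (auto simp: unshift_perm_def)
  qed
  ultimately show "bij_betw (unshift_perm d b) {d+1..d+m} {d+1..d+m}"
    by (simp add: bij_betw_def endo_inj_surj)
next
  fix i assume "i \<notin> {d+1..d+m}"
  then have "i \<le> d \<or> b (i - d) = i - d \<and> d < i"
    using permutes_not_in[OF assms, of "i - d"] by fastforce
  then show "unshift_perm d b i = i" by (auto simp: unshift_perm_def)
qed

lemma shift_unshift_perm [simp]:
  assumes "b permutes {1..m}"
  shows "shift_perm d (unshift_perm d b) = b"
  using permutes_not_in[OF assms, of 0] by (auto simp: shift_perm_def unshift_perm_def fun_eq_iff)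

lemma unshift_shift_perm [simp]:
  assumes "b permutes {d+1..d+m}"
  shows "unshift_perm d (shift_perm d b) = b"
proof
  fix i show "unshift_perm d (shift_perm d b) i = b i"
  proof (cases "i \<in> {d+1..d+m}")
    case True
    then have "b i \<in> {d+1..d+m}" using permutes_in_image[OF assms] by blast
    then show ?thesis using True by (auto simp: unshift_perm_def shift_perm_def)
  next
    case False
    then show ?thesis using permutes_not_in[OF assms False]
      by (auto simp: unshift_perm_def shift_perm_def)
  qed
qed

lemma lift_permutes:
  assumes "u permutes {1..k + m}"
  shows "lift k u permutes {1..Suc (k + m)}"
proof (rule bij_imp_permutes)
  have r: "1 \<le> u i \<and> u i \<le> k + m" if "1 \<le> i" "i \<le> k + m" for i
    using permutes_in_image[OF assms, of i] that by auto
  have "inj_on (lift k u) {1..Suc (k + m)}"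
  proof (rule inj_onI)
    fix i j assume ij: "i \<in> {1..Suc (k + m)}" "j \<in> {1..Suc (k + m)}" "lift k u i = lift k u j"
    define p where "p i = (if i \<le> k then i else i - 1)" for i
    have eq: "lift k u i = Suc (u (p i))" "u (p i) \<noteq> 0"
      if "i \<in> {1..Suc (k + m)}" "i \<noteq> Suc k" for i
    proof -
      have "1 \<le> p i" "p i \<le> k + m" using that by (auto simp: p_def)
      then show "u (p i) \<noteq> 0" using r[of "p i"] by simp
      show "lift k u i = Suc (u (p i))" using that by (auto simp: lift_def p_def)
    qed
    have one: "lift k u (Suc k) = 1" by (simp add: lift_def)
    show "i = j"
    proof (cases "i = Suc k \<or> j = Suc k")
      case True
      then show ?thesis using ij eq[of i] eq[of j] one by (metis One_nat_def Suc_inject)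
    next
      case False
      then have "u (p i) = u (p j)" using ij eq[of i] eq[of j] by simp
      then have "p i = p j" using permutes_inj[OF assms] by (simp add: inj_eq)
      then show ?thesis using False ij(1,2) by (auto simp: p_def split: if_splits)
    qed
  qed
  moreover have "lift k u ` {1..Suc (k + m)} \<subseteq> {1..Suc (k + m)}"
    using r by (auto simp: lift_def)
  ultimately show "bij_betw (lift k u) {1..Suc (k + m)} {1..Suc (k + m)}"
    by (simp add: bij_betw_def endo_inj_surj)
next
  fix i assume "i \<notin> {1..Suc (k + m)}"
  then have "i = 0 \<or> i > Suc k \<and> u (i - 1) = i - 1"
    using permutes_not_in[OF assms, of "i - 1"] by fastforce
  then show "lift k u i = i" by (auto simp: lift_def)
qed

lemma strict_mono_on_no_descents:
  assumes "u permutes {1..n}" "\<And>i. \<lbrakk>l \<le> i; i < h\<rbrakk> \<Longrightarrow> i \<notin> descents n u" "1 \<le> l" "h \<le> n"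
  shows "strict_mono_on {l..h} u"
proof (rule strict_mono_onI)
  fix r s assume rs: "r \<in> {l..h}" "s \<in> {l..h}" "r < s"
  have step: "u i < u (Suc i)" if "l \<le> i" "i < h" for i
  proof -
    have "\<not> u (Suc i) < u i" using assms(2)[OF that] assms(3,4) that by (auto simp: descents_def)
    moreover have "u (Suc i) \<noteq> u i" using permutes_inj[OF assms(1)] by (simp add: inj_eq)
    ultimately show ?thesis by simp
  qed
  have "s \<le> h \<Longrightarrow> u r < u s" using \<open>r < s\<close>
  proof (induction s)
    case (Suc s)
    then show ?case using step[of s] rs(1) by (cases "r = s") auto
  qed simp
  then show "u r < u s" using rs(2) by simp
qed

lemma grassmann_perms_strict_mono:
  assumes "u \<in> grassmann_perms k m"
  shows "strict_mono_on {1..k} u" "strict_mono_on {k+1..k+m} u"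
  using assms by (auto simp: grassmann_perms_def intro!: strict_mono_on_no_descents[of u "k + m"])

text \<open>Subtracting \<open>i\<close> from the increasing values \<open>u i\<close> turns a permutation with no descent except at
  \<open>k\<close> into a partition; this allows sums over partitions to be read as sums over a descent class.\<close>

lemma grassmann_perms_iff:
  "u \<in> grassmann_perms k m \<longleftrightarrow> (\<exists>lam. in_rectangle k m lam \<and> is_grassmann (k + m) lam u)"
proof
  assume "\<exists>lam. in_rectangle k m lam \<and> is_grassmann (k + m) lam u"
  then have u: "u permutes {1..k+m}" "strict_mono_on {1..k} u" "strict_mono_on {k+1..k+m} u"
    by (auto simp: is_grassmann_def in_rectangle_def Let_def)
  have "i = k" if "i \<in> descents (k + m) u" for i
  proof (rule ccontr)
    assume "i \<noteq> k"
    then have "u i < u (Suc i)"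
      using that strict_mono_onD[OF u(2), of i "Suc i"] strict_mono_onD[OF u(3), of i "Suc i"]
      by (cases "i < k") (auto simp: descents_def)
    then show False using that by (simp add: descents_def)
  qed
  then show "u \<in> grassmann_perms k m" using u(1) by (auto simp: grassmann_perms_def)
next
  assume *: "u \<in> grassmann_perms k m"
  then have u: "u permutes {1..k+m}" by (simp add: grassmann_perms_def)
  note mono = grassmann_perms_strict_mono[OF *]
  have gap: "u i + (j - i) \<le> u j" if "1 \<le> i" "i \<le> j" "j \<le> k" for i j
    using strict_mono_on_gap[OF mono(1)] that by blast
  have ur: "u i \<in> {1..k+m}" if "i \<in> {1..k+m}" for i using permutes_in_image[OF u] that by blast
  have ge: "i \<le> u i" if "i \<in> {1..k}" for i
    using gap[of 1 i] ur[of 1] that by auto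
  define lam where "lam = map (\<lambda>j. u (k - j) - (k - j)) [0..<k]"
  have len: "length lam = k" by (simp add: lam_def)
  have nth: "u i = lam ! (k - i) + i" if "i \<in> {1..k}" for i
    using that ge[OF that] by (auto simp: lam_def)
  have "lam ! j \<le> lam ! i" if "i < j" "j < k" for i j
  proof -
    have "u (k - j) + (j - i) \<le> u (k - i)" "k - j \<le> u (k - j)"
      using gap[of "k - j" "k - i"] ge[of "k - j"] that by auto
    then have "u (k - j) - (k - j) \<le> u (k - i) - (k - i)" using that by linarith
    then show ?thesis using that by (simp add: lam_def)
  qed
  moreover have "lam ! j \<le> m" if "j < k" for j
  proof -
    have "u (k - j) + j \<le> u k" "u k \<le> k + m" using gap[of "k - j" k] ur[of k] that by auto
    then show ?thesis using that by (simp add: lam_def)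
  qed
  ultimately have "in_rectangle k m lam"
    unfolding in_rectangle_def by (auto simp: len sorted_wrt_iff_nth_less in_set_conv_nth)
  moreover have "is_grassmann (k + m) lam u"
    using u mono nth len by (simp add: is_grassmann_def)
  ultimately show "\<exists>lam. in_rectangle k m lam \<and> is_grassmann (k + m) lam u" by blast
qed

lemma grassmann_eqI:
  assumes "in_rectangle k m lam" "is_grassmann (k + m) lam u"
  shows "grassmann (k + m) lam = u"
  unfolding grassmann_def using ex1_is_grassmann[of k "k + m" lam] assms
  by (intro the1_equality) auto

lemma in_rectangle_map_Suc:
  "in_rectangle k m lam \<Longrightarrow> in_rectangle k (Suc m) (map Suc lam)"
  by (auto simp: in_rectangle_def sorted_wrt_map)

text \<open>Adding one to each of the \<open>k\<close> parts undoes the passage from \<open>\<lambda>\<close> to the partition with hat that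
  occurs in the recursion for the weight.\<close>

lemma is_grassmann_lift:
  assumes "in_rectangle k m lam" "is_grassmann (k + m) lam u"
  shows "is_grassmann (Suc (k + m)) (map Suc lam) (lift k u)"
proof -
  have len: "length lam = k" using assms(1) by (simp add: in_rectangle_def)
  have u: "u permutes {1..k+m}" "strict_mono_on {1..k} u" "strict_mono_on {k+1..k+m} u"
    "\<And>i. i \<in> {1..k} \<Longrightarrow> u i = lam ! (k - i) + i"
    using assms(2) len by (auto simp: is_grassmann_def Let_def)
  have pos: "0 < u i" if "i \<in> {1..k+m}" for i using permutes_in_image[OF u(1), of i] that by auto
  have "strict_mono_on {1..k} (lift k u)"
    using strict_mono_onD[OF u(2)] by (intro strict_mono_onI) (auto simp: lift_def)
  moreover have "strict_mono_on {k+1..Suc (k + m)} (lift k u)"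
  proof (intro strict_mono_onI)
    fix r s assume rs: "r \<in> {k+1..Suc (k+m)}" "s \<in> {k+1..Suc (k+m)}" "r < s"
    show "lift k u r < lift k u s"
    proof (cases "r = Suc k")
      case True
      have "s - 1 \<in> {1..k+m}" using rs by auto
      then show ?thesis using pos[of "s - 1"] True rs by (simp add: lift_def)
    next
      case False
      then have "r - 1 \<in> {k+1..k+m}" "s - 1 \<in> {k+1..k+m}" "r - 1 < s - 1" using rs by auto
      then have "u (r - 1) < u (s - 1)" by (rule strict_mono_onD[OF u(3)])
      then show ?thesis using False rs by (simp add: lift_def)
    qed
  qed
  ultimately show ?thesis
    using lift_permutes[OF u(1)] u(4) len by (auto simp: is_grassmann_def Let_def lift_def)
qed

lemma glue_apply:
  assumes "a permutes {1..k}" "b permutes {1..m}"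
  shows glue_low: "i \<in> {1..k} \<Longrightarrow> glue k u a b i = Suc (u (a i))"
    and glue_mid: "glue k u a b (Suc k) = 1"
    and glue_high: "j \<in> {1..m} \<Longrightarrow> glue k u a b (Suc k + j) = Suc (u (k + b j))"
proof -
  show "glue k u a b i = Suc (u (a i))" if "i \<in> {1..k}"
  proof -
    have "a i \<in> {1..k}" using permutes_in_image[OF assms(1)] that by blast
    then show ?thesis using that by (simp add: glue_def lift_def unshift_perm_def)
  qed
  show "glue k u a b (Suc k) = 1"
    using permutes_not_in[OF assms(1), of "Suc k"] by (simp add: glue_def lift_def unshift_perm_def)
  show "glue k u a b (Suc k + j) = Suc (u (k + b j))" if "j \<in> {1..m}"
  proof -
    have "b j \<in> {1..m}" using permutes_in_image[OF assms(2)] that by blast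
    moreover have "unshift_perm (Suc k) b (Suc k + j) = Suc (k + b j)"
      using that by (simp add: unshift_perm_def)
    moreover have "a (Suc (k + b j)) = Suc (k + b j)" by (rule permutes_not_in[OF assms(1)]) simp
    ultimately show ?thesis by (simp add: glue_def lift_def)
  qed
qed

lemma glue_permutes:
  assumes "u permutes {1..k + m}" "a permutes {1..k}" "b permutes {1..m}"
  shows "glue k u a b permutes {1..Suc (k + m)}"
proof -
  have "a permutes {1..Suc (k + m)}" by (rule permutes_subset[OF assms(2)]) auto
  moreover have "unshift_perm (Suc k) b permutes {1..Suc (k + m)}"
    by (rule permutes_subset[OF unshift_perm_permutes[OF assms(3)]]) auto
  ultimately show ?thesis
    unfolding glue_def using lift_permutes[OF assms(1)] by (intro permutes_compose)
qed

lemma is_factorization_iff: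
  assumes "w permutes {1..n}" "w (Suc k) = 1"
  shows "is_factorization n w lam a b \<longleftrightarrow> in_rectangle k (n - k) lam \<and> a permutes {1..k} \<and>
    b permutes {k+2..n} \<and> w = grassmann n lam \<circ> a \<circ> b"
proof -
  have "Hilbert_Choice.inv w 1 = Suc k" using permutes_inv_eq[OF assms(1)] assms(2) by blast
  then show ?thesis unfolding is_factorization_def by simp
qed

lemma is_factorization_glue:
  assumes "in_rectangle k m lam" "is_grassmann (k + m) lam u"
    "a permutes {1..k}" "b permutes {1..m}"
  shows "is_factorization (Suc (k + m)) (glue k u a b) (map Suc lam) a (unshift_perm (Suc k) b)"
proof -
  have "u permutes {1..k + m}" using assms(2) by (simp add: is_grassmann_def Let_def)
  note w = glue_permutes[OF this assms(3,4)]
  have "grassmann (k + Suc m) (map Suc lam) = lift k u"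
    using is_grassmann_lift[OF assms(1,2)]
    by (intro grassmann_eqI in_rectangle_map_Suc assms(1)) simp
  moreover have "unshift_perm (Suc k) b permutes {k+2..Suc (k + m)}"
    using unshift_perm_permutes[OF assms(4), of "Suc k"] by simp
  ultimately show ?thesis
    unfolding is_factorization_iff[OF w glue_mid[OF assms(3,4)]]
    using in_rectangle_map_Suc[OF assms(1)] assms(3) by (simp add: glue_def Suc_diff_le)
qed

lemma factorization_eq:
  assumes "w permutes {1..n}" "n \<ge> 1"
    and "is_factorization n w lam a b" "is_factorization n w lam' a' b'"
  shows "lam = lam' \<and> a = a' \<and> b = b'"
  using ex1_is_factorization[OF assms(1,2)] assms(3,4) by auto

text \<open>Injectivity and surjectivity are the uniqueness and existence of the factorization of \<open>w\<close>.
  That the value 1 stands at position \<open>k + 1\<close> forces all \<open>k\<close> parts of the partition to be positive,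
  so one can be subtracted from each.\<close>

lemma bij_betw_glue:
  "bij_betw (\<lambda>(u, a, b). glue k u a b)
     (grassmann_perms k m \<times> {a. a permutes {1..k}} \<times> {b. b permutes {1..m}})
     {w. w permutes {1..Suc (k + m)} \<and> w (Suc k) = 1}"
  unfolding bij_betw_def
proof
  let ?n = "Suc (k + m)"
  show "inj_on (\<lambda>(u, a, b). glue k u a b)
     (grassmann_perms k m \<times> {a. a permutes {1..k}} \<times> {b. b permutes {1..m}})"
  proof (rule inj_onI, clarsimp)
    fix u a b u' a' b'
    assume u: "u \<in> grassmann_perms k m" "u' \<in> grassmann_perms k m"
      and a: "a permutes {Suc 0..k}" "a' permutes {Suc 0..k}"
      and b: "b permutes {Suc 0..m}" "b' permutes {Suc 0..m}"
      and eq: "glue k u a b = glue k u' a' b'"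
    obtain lam where l: "in_rectangle k m lam" "is_grassmann (k + m) lam u"
      using u grassmann_perms_iff by blast
    obtain lam' where l': "in_rectangle k m lam'" "is_grassmann (k + m) lam' u'"
      using u grassmann_perms_iff by blast
    have "glue k u a b permutes {1..?n}"
      using glue_permutes u a b by (simp add: grassmann_perms_def)
    from factorization_eq[OF this _ is_factorization_glue[OF l] is_factorization_glue[OF l', of a' b', folded eq]]
    have *: "map Suc lam = map Suc lam'" "a = a'"
        "unshift_perm (Suc k) b = unshift_perm (Suc k) b'"
      using a b by auto
    have "lam = lam'" using *(1) by (simp add: inj_map_eq_map)
    then have "u = u'" using grassmann_eqI l l' by blast
    moreover have "b = b'" using *(3) b shift_unshift_perm by (metis One_nat_def)
    ultimately show "u = u' \<and> a = a' \<and> b = b'" using *(2) by blast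
  qed
  show "(\<lambda>(u, a, b). glue k u a b) `
     (grassmann_perms k m \<times> {a. a permutes {1..k}} \<times> {b. b permutes {1..m}}) =
     {w. w permutes {1..Suc (k + m)} \<and> w (Suc k) = 1}" (is "?f ` ?D = ?R")
  proof
    show "?f ` ?D \<subseteq> ?R"
      using glue_permutes glue_mid by (auto simp: grassmann_perms_def)
    show "?R \<subseteq> ?f ` ?D"
    proof
      fix w assume "w \<in> ?R"
      then have w: "w permutes {1..?n}" "w (Suc k) = 1" by auto
      obtain lam a b where "is_factorization ?n w lam a b"
        using ex1_is_factorization[OF w(1)] by auto
      then have f: "in_rectangle k (Suc m) lam" "a permutes {1..k}" "b permutes {k+2..?n}"
          "w = grassmann ?n lam \<circ> a \<circ> b"
        by (simp_all add: is_factorization_iff[OF w] Suc_diff_le)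
      have len: "length lam = k" using f(1) by (simp add: in_rectangle_def)
      have g: "is_grassmann ?n lam (grassmann ?n lam)"
        using is_grassmann_grassmann[of k ?n lam] f(1) by (simp add: Suc_diff_le)
      have "grassmann ?n lam (Suc k) = 1"
        using w(2) f(4) permutes_not_in[OF f(2), of "Suc k"] permutes_not_in[OF f(3), of "Suc k"]
        by simp
      have pos: "x > 0" if x: "x \<in> set lam" for x
      proof (rule ccontr)
        \<comment> \<open>A zero part makes the smallest part zero, and then 1 already is the first value.\<close>
        assume "\<not> x > 0"
        then obtain j where j: "j < k" "lam ! j = 0" using x len by (auto simp: in_set_conv_nth)
        then have "lam ! (k - 1) \<le> lam ! j"
          using f(1) sorted_wrt_nth_less[of "(\<ge>)" lam j "k - 1"] len
          by (cases "j = k - 1") (auto simp: in_rectangle_def)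
        then have "grassmann ?n lam 1 = 1"
          using g j len by (auto simp: is_grassmann_def Let_def)
        moreover have "inj (grassmann ?n lam)"
          using g by (auto simp: is_grassmann_def Let_def intro: permutes_inj)
        ultimately have "(1::nat) = Suc k"
          using \<open>grassmann ?n lam (Suc k) = 1\<close> by (metis injD)
        then show False using j by simp
      qed
      define mu where "mu = map (\<lambda>x. x - 1) lam"
      have lam: "lam = map Suc mu"
        unfolding mu_def map_map using pos by (intro map_idI[symmetric]) auto
      have mu: "in_rectangle k m mu"
        using f(1) unfolding lam by (auto simp: in_rectangle_def sorted_wrt_map)
      define u where "u = grassmann (k + m) mu"
      have u: "is_grassmann (k + m) mu u"
        unfolding u_def using is_grassmann_grassmann[of k "k + m" mu] mu by simp
      have "grassmann ?n lam = lift k u"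
        unfolding lam using grassmann_eqI[OF in_rectangle_map_Suc[OF mu]] is_grassmann_lift[OF mu u]
        by simp
      moreover have b: "b permutes {Suc k + 1..Suc k + m}" using f(3) by simp
      ultimately have "w = glue k u a (shift_perm (Suc k) b)"
        using f(4) by (simp add: glue_def unshift_shift_perm[OF b])
      moreover have "u \<in> grassmann_perms k m" using mu u grassmann_perms_iff by blast
      ultimately show "w \<in> ?f ` ?D"
        using f(2) shift_perm_permutes[OF b] by force
    qed
  qed
qed

section \<open>Weight and descents after removing the value 1\<close>

lemma wt_glue:
  assumes "u \<in> grassmann_perms k m" "a permutes {1..k}" "b permutes {1..m}"
  shows "wt (Suc (k + m)) (glue k u a b) = tpow (qexp k - 1) * (phi (qt_fact k) / qt_fact k) *
    phi (wt (k + m) u) * wt k a * (phi ^^ Suc k) (wt m b)"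
proof -
  let ?n = "Suc (k + m)" and ?w = "glue k u a b"
  have up: "u permutes {1..k + m}" using assms(1) by (simp add: grassmann_perms_def)
  note w = glue_permutes[OF up assms(2,3)]
  show ?thesis
  proof (cases "k + m = 0")
    case True
    have one: "wt n v = 1" if "n \<le> 1" for n v using that by (subst wt.simps) simp
    have "qexp 0 = 1" by (simp add: qexp_def)
    then show ?thesis using True by (simp add: one phi_1 tpow_def qt_fact_def)
  next
    case False
    obtain lam where l: "in_rectangle k m lam" "is_grassmann (k + m) lam u"
      using assms(1) grassmann_perms_iff by blast
    have "Hilbert_Choice.inv ?w 1 = Suc k"
      using permutes_inv_eq[OF w] glue_mid[OF assms(2,3)] by blast
    then have inv: "Hilbert_Choice.inv ?w 1 - 1 = k" by simp
    have the: "(THE (lam, a, b). is_factorization ?n ?w lam a b) =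
        (map Suc lam, a, unshift_perm (Suc k) b)"
    proof (rule the1_equality)
      show "\<exists>!(lam, a, b). is_factorization ?n ?w lam a b"
        by (rule ex1_is_factorization[OF w]) simp
    qed (simp only: prod.case is_factorization_glue[OF l assms(2,3)])
    have "wt ?n ?w = tpow (qexp k - 1) * (phi (qt_fact k) / qt_fact k) *
        phi (wt (?n - 1) (grassmann (?n - 1) (map (\<lambda>x. x - 1) (map Suc lam)))) * wt k a *
        (phi ^^ (k + 1)) (wt (?n - k - 1) (shift_perm (k + 1) (unshift_perm (Suc k) b)))"
    proof -
      have "\<not> (?n \<le> 1 \<or> \<not> ?w permutes {1..?n})" using w False by simp
      then show ?thesis
        by (subst wt.simps, subst if_not_P) (simp_all only: inv the Let_def prod.case)
    qed
    also have "grassmann (?n - 1) (map (\<lambda>x. x - 1) (map Suc lam)) = u"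
      using grassmann_eqI[OF l] by (simp add: comp_def)
    finally show ?thesis using shift_unshift_perm[OF assms(3)] by simp
  qed
qed

lemma descents_glue:
  assumes "u \<in> grassmann_perms k m" "a permutes {1..k}" "b permutes {1..m}"
  shows "descents (Suc (k + m)) (glue k u a b) =
    descents k a \<union> (if k = 0 then {} else {k}) \<union> (+) (Suc k) ` descents m b"
proof (rule Set.set_eqI)
  fix i
  have up: "u permutes {1..k + m}" using assms(1) by (simp add: grassmann_perms_def)
  note mono = grassmann_perms_strict_mono[OF assms(1)]
  have less1: "u x < u y \<longleftrightarrow> x < y" if "x \<in> {1..k}" "y \<in> {1..k}" for x y
    using strict_mono_on_less[OF mono(1)] that by auto
  have less2: "u x < u y \<longleftrightarrow> x < y" if "x \<in> {k+1..k+m}" "y \<in> {k+1..k+m}" for x y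
    using strict_mono_on_less[OF mono(2)] that by auto
  have ra: "a x \<in> {1..k}" if "x \<in> {1..k}" for x using permutes_in_image[OF assms(2)] that by blast
  have rb: "b x \<in> {1..m}" if "x \<in> {1..m}" for x using permutes_in_image[OF assms(3)] that by blast
  note low = glue_low[OF assms(2,3)] and mid = glue_mid[OF assms(2,3)] and high = glue_high[OF assms(2,3)]
  consider "i = 0 \<or> i > k + m" | "1 \<le> i" "i < k" | "i = k" "k > 0" | "i = Suc k" "m > 0"
    | "i = Suc k + (i - Suc k)" "1 \<le> i - Suc k" "i - Suc k < m"
    by linarith
  then show "i \<in> descents (Suc (k + m)) (glue k u a b) \<longleftrightarrow>
    i \<in> descents k a \<union> (if k = 0 then {} else {k}) \<union> (+) (Suc k) ` descents m b"
  proof cases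
    case 1
    then show ?thesis by (auto simp: descents_def)
  next
    case 2
    then show ?thesis using low[of i u] low[of "Suc i" u] less1[of "a (Suc i)" "a i"] ra
      by (auto simp: descents_def)
  next
    case 3
    have "u (a k) \<in> {1..k+m}" using ra[of k] permutes_in_image[OF up, of "a k"] 3 by auto
    then show ?thesis using 3 low[of k u] mid[of u] by (auto simp: descents_def)
  next
    case 4
    then show ?thesis using mid[of u] high[of 1 u] by (auto simp: descents_def)
  next
    case 5
    define j where "j = i - Suc k"
    have i: "i = Suc k + j" and j: "1 \<le> j" "j < m" using 5 by (simp_all add: j_def)
    then have "b j \<in> {1..m}" "b (Suc j) \<in> {1..m}" using rb by auto
    then have "u (k + b (Suc j)) < u (k + b j) \<longleftrightarrow> b (Suc j) < b j"
      using less2[of "k + b (Suc j)" "k + b j"] by auto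
    then show ?thesis using j high[of j u] high[of "Suc j" u]
      unfolding i by (auto simp: descents_def)
  qed
qed

section \<open>Partial sums of weak compositions\<close>

lemma partial_sum_mono: "i \<le> j \<Longrightarrow> partial_sum \<alpha> i \<le> partial_sum \<alpha> j"
  unfolding partial_sum_def by (metis le_add_same_cancel1 le_add1 min.absorb1 sum_list_append take_add nat_le_iff_add)

lemma partial_sum_Suc: "i < length \<alpha> \<Longrightarrow> partial_sum \<alpha> (Suc i) = partial_sum \<alpha> i + \<alpha> ! i"
  by (simp add: partial_sum_def take_Suc_conv_app_nth)

lemma partial_sum_length: "partial_sum \<alpha> (length \<alpha>) = sum_list \<alpha>"
  by (simp add: partial_sum_def)

text \<open>Zero parts repeat a partial sum; indexing by the positive parts counts each value below the
  total once.\<close>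

lemma bij_betw_partial_sum:
  "bij_betw (partial_sum \<alpha>) {s. s < length \<alpha> \<and> 0 < \<alpha> ! s} (psums \<alpha> \<inter> {..<sum_list \<alpha>})"
  unfolding bij_betw_def
proof
  have less: "partial_sum \<alpha> s < partial_sum \<alpha> t" if "s < length \<alpha>" "0 < \<alpha> ! s" "s < t" for s t
    using partial_sum_mono[of "Suc s" t \<alpha>] partial_sum_Suc[of s \<alpha>] that by simp
  show "inj_on (partial_sum \<alpha>) {s. s < length \<alpha> \<and> 0 < \<alpha> ! s}"
    by (rule inj_onI) (use less in \<open>metis (no_types, lifting) mem_Collect_eq nat_neq_iff\<close>)
  show "partial_sum \<alpha> ` {s. s < length \<alpha> \<and> 0 < \<alpha> ! s} = psums \<alpha> \<inter> {..<sum_list \<alpha>}" (is "?A = ?B")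
  proof
    show "?A \<subseteq> ?B"
      using less[of _ "length \<alpha>"] by (auto simp: psums_def partial_sum_length)
    show "?B \<subseteq> ?A"
    proof
      fix k assume "k \<in> ?B"
      then have k: "k < sum_list \<alpha>" and ex: "\<exists>s. s \<le> length \<alpha> \<and> partial_sum \<alpha> s = k"
        by (auto simp: psums_def)
      define s where "s = (GREATEST s. s \<le> length \<alpha> \<and> partial_sum \<alpha> s = k)"
      have s: "s \<le> length \<alpha> \<and> partial_sum \<alpha> s = k"
        unfolding s_def by (rule GreatestI_ex_nat[OF ex, of "length \<alpha>"]) simp
      then have "s < length \<alpha>" using k partial_sum_length[of \<alpha>] by (cases "s = length \<alpha>") auto
      moreover have "\<alpha> ! s \<noteq> 0"
      proof
        assume "\<alpha> ! s = 0"
        then have "Suc s \<le> length \<alpha> \<and> partial_sum \<alpha> (Suc s) = k"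
          using s \<open>s < length \<alpha>\<close> by (simp add: partial_sum_Suc)
        then have "Suc s \<le> s"
          unfolding s_def by (rule Greatest_le_nat[where b = "length \<alpha>"]) simp
        then show False by simp
      qed
      ultimately show "k \<in> ?A" using s by auto
    qed
  qed
qed

section \<open>Weights that split along the removal of 1\<close>

lemma image_Collect_inter: "f ` {z \<in> X. P (f z)} = {w \<in> f ` X. P w}"
  by blast

lemma field_hom_funpow:
  fixes h :: "'a::field \<Rightarrow> 'a"
  assumes "field_hom h"
  shows "field_hom (h ^^ k)"
proof (induction k)
  case 0
  show ?case by unfold_locales auto
next
  case (Suc k)
  interpret h: field_hom h by fact
  interpret p: field_hom "h ^^ k" by fact
  show ?case by unfold_locales (auto simp: h.hom_add h.hom_mult p.hom_add p.hom_mult)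
qed

text \<open>Here \<open>fac\<close> is the factorial, \<open>hom\<close> the automorphism that shifts its indeterminates, and
  \<open>c k * (hom (fac k) / fac k)\<close> the factor that is picked up when the value 1 is removed from
  position \<open>k + 1\<close>. The assumption \<open>bracket\<close> is the telescoping identity: up to
  \<open>c k\<close>, extending a block to the left so that it begins at \<open>k\<close> and not at \<open>k + 1\<close> multiplies its
  factorial by an increment of \<open>psi\<close>.\<close>

locale ribbon_weight = field_hom hom for hom :: "'a::field \<Rightarrow> 'a" +
  fixes fac c psi :: "nat \<Rightarrow> 'a" and W :: "nat \<Rightarrow> (nat \<Rightarrow> nat) \<Rightarrow> 'a"
  assumes fac_nonzero: "fac n \<noteq> 0"
    and fac_0: "fac 0 = 1"
    and c_0: "c 0 = 1"
    and psi_0: "psi 0 = 0"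
    and bracket: "c k * (hom ^^ k) (fac (Suc d)) = (psi (k + Suc d) - psi k) * (hom ^^ Suc k) (fac d)"
    and W_0: "W 0 id = 1"
    and W_glue: "\<lbrakk>u \<in> grassmann_perms k m; a permutes {1..k}; b permutes {1..m}\<rbrakk> \<Longrightarrow>
      W (Suc (k + m)) (glue k u a b) =
        c k * (hom (fac k) / fac k) * hom (W (k + m) u) * W k a * (hom ^^ Suc k) (W m b)"
begin

sublocale pow: field_hom "hom ^^ k" for k
  by (rule field_hom_funpow) (rule field_hom_axioms)

text \<open>The denominator of the multinomial coefficient, with the first block beginning at \<open>p\<close>.\<close>

fun den :: "nat \<Rightarrow> nat list \<Rightarrow> 'a" where
  "den p [] = 1"
| "den p (a # \<alpha>) = (hom ^^ p) (fac a) * den (p + a) \<alpha>"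

lemma den_append: "den p (\<alpha> @ \<beta>) = den p \<alpha> * den (p + sum_list \<alpha>) \<beta>"
  by (induction \<alpha> arbitrary: p) (auto simp: add.assoc)

lemma den_nonzero: "den p \<alpha> \<noteq> 0"
  by (induction \<alpha> arbitrary: p) (auto simp: fac_nonzero)

lemma hom_den: "(hom ^^ k) (den p \<alpha>) = den (k + p) \<alpha>"
  by (induction \<alpha> arbitrary: p) (auto simp: pow.hom_mult funpow_add add.assoc)

lemma den_prod:
  "den p \<beta> = (\<Prod>s<length \<beta>. (hom ^^ (p + partial_sum \<beta> s)) (fac (\<beta> ! s)))"
  by (induction \<beta> arbitrary: p) (simp_all add: prod.lessThan_Suc_shift add.assoc del: prod.lessThan_Suc)

lemma fac_Suc: "fac (Suc d) = psi (Suc d) * hom (fac d)"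
  using bracket[of 0 d] by (simp add: c_0 psi_0)

definition subset_sum :: "nat \<Rightarrow> nat list \<Rightarrow> 'a" where
  "subset_sum n \<alpha> = (\<Sum>w | w permutes {1..n} \<and> descents n w \<subseteq> psums \<alpha>. W n w)"

text \<open>Given the part \<open>Suc d\<close> that begins at \<open>k\<close>, the descents of the three pieces are constrained
  independently. The position \<open>k + 1\<close> of the value 1 uses up one place of that part, so \<open>b\<close> is
  constrained by \<open>d # ys\<close>; as \<open>d\<close> may be 0, this is where weak compositions enter. The condition
  on \<open>u\<close> also is of this kind, for the composition \<open>[k, m]\<close>.\<close>

lemma sum_one_at:
  assumes "sum_list xs = k" "m = d + sum_list ys"
  shows "(\<Sum>w | w permutes {1..Suc (k + m)} \<and> w (Suc k) = 1 \<and>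
       descents (Suc (k + m)) w \<subseteq> psums (xs @ Suc d # ys). W (Suc (k + m)) w) =
    c k * (hom (fac k) / fac k) * hom (subset_sum (k + m) [k, m]) * subset_sum k xs *
      (hom ^^ Suc k) (subset_sum m (d # ys))"
proof -
  let ?\<alpha> = "xs @ Suc d # ys" and ?n = "Suc (k + m)"
  let ?U = "grassmann_perms k m"
  let ?A = "{a. a permutes {1..k} \<and> descents k a \<subseteq> psums xs}"
  let ?B = "{b. b permutes {1..m} \<and> descents m b \<subseteq> psums (d # ys)}"
  let ?g = "\<lambda>(u, a, b). glue k u a b"
  let ?P = "\<lambda>w. descents ?n w \<subseteq> psums ?\<alpha>"
  have psums: "psums ?\<alpha> = psums xs \<union> (+) k ` psums (Suc d # ys)"
    unfolding psums_append assms(1) ..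
  have k: "k \<in> psums ?\<alpha>" unfolding psums by auto
  have a: "descents k a \<subseteq> psums ?\<alpha> \<longleftrightarrow> descents k a \<subseteq> psums xs" for a
  proof -
    have "i \<in> psums ?\<alpha> \<longleftrightarrow> i \<in> psums xs" if "i \<in> descents k a" for i
      using that unfolding psums by (auto simp: descents_def simp del: psums_Cons)
    then show ?thesis by blast
  qed
  have b: "(+) (Suc k) ` descents m b \<subseteq> psums ?\<alpha> \<longleftrightarrow> descents m b \<subseteq> psums (d # ys)" for b
  proof -
    have "Suc k + i \<in> psums ?\<alpha> \<longleftrightarrow> i \<in> psums (d # ys)" if "1 \<le> i" for i
    proof -
      have "Suc k + i \<notin> psums xs" using psums_le[of "Suc k + i" xs] assms(1) by auto
      then have "Suc k + i \<in> psums ?\<alpha> \<longleftrightarrow> Suc i \<in> psums (Suc d # ys)"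
        unfolding psums by (auto simp: image_iff)
      also have "\<dots> \<longleftrightarrow> i \<in> psums (d # ys)" using that by (auto simp: image_iff)
      finally show ?thesis .
    qed
    moreover have "1 \<le> i" if "i \<in> descents m b" for i using that by (simp add: descents_def)
    ultimately have "Suc k + i \<in> psums ?\<alpha> \<longleftrightarrow> i \<in> psums (d # ys)" if "i \<in> descents m b" for i
      using that by blast
    then show ?thesis by blast
  qed
  have "?g ` (?U \<times> ?A \<times> ?B) = {w. w permutes {1..?n} \<and> w (Suc k) = 1 \<and> descents ?n w \<subseteq> psums ?\<alpha>}"
  proof -
    have iff: "descents ?n (glue k u x y) \<subseteq> psums ?\<alpha> \<longleftrightarrow>
        descents k x \<subseteq> psums xs \<and> descents m y \<subseteq> psums (d # ys)"
      if "u \<in> ?U" "x permutes {1..k}" "y permutes {1..m}" for u x y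
      unfolding descents_glue[OF that] Un_subset_iff a b using k
      by (cases "k = 0") (simp_all del: psums_Cons)
    have "?U \<times> ?A \<times> ?B = {z \<in> ?U \<times> {a. a permutes {1..k}} \<times> {b. b permutes {1..m}}.
        descents ?n (?g z) \<subseteq> psums ?\<alpha>}"
    proof (rule Set.set_eqI)
      fix z :: "(nat \<Rightarrow> nat) \<times> (nat \<Rightarrow> nat) \<times> (nat \<Rightarrow> nat)"
      obtain u x y where z: "z = (u, x, y)" by (cases z)
      show "z \<in> ?U \<times> ?A \<times> ?B \<longleftrightarrow> z \<in> {z \<in> ?U \<times> {a. a permutes {1..k}} \<times>
          {b. b permutes {1..m}}. descents ?n (?g z) \<subseteq> psums ?\<alpha>}"
        unfolding z mem_Sigma_iff mem_Collect_eq prod.case using iff[of u x y] by meson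
    qed
    then have "?g ` (?U \<times> ?A \<times> ?B) =
        ?g ` {z \<in> ?U \<times> {a. a permutes {1..k}} \<times> {b. b permutes {1..m}}. ?P (?g z)}"
      by (rule arg_cong)
    also have "\<dots> = {w \<in> ?g ` (?U \<times> {a. a permutes {1..k}} \<times> {b. b permutes {1..m}}). ?P w}"
      unfolding image_Collect_inter[of ?g _ ?P] ..
    also have "\<dots> = {w. w permutes {1..?n} \<and> w (Suc k) = 1 \<and> ?P w}"
      unfolding bij_betw_imp_surj_on[OF bij_betw_glue] by (simp only: mem_Collect_eq conj_assoc)
    finally show ?thesis .
  qed
  moreover have "inj_on ?g (?U \<times> ?A \<times> ?B)"
    by (rule inj_on_subset[OF bij_betw_imp_inj_on[OF bij_betw_glue]]) auto
  ultimately have "bij_betw ?g (?U \<times> ?A \<times> ?B)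
      {w. w permutes {1..?n} \<and> w (Suc k) = 1 \<and> descents ?n w \<subseteq> psums ?\<alpha>}"
    by (simp only: bij_betw_def)
  then have "(\<Sum>w | w permutes {1..?n} \<and> w (Suc k) = 1 \<and> descents ?n w \<subseteq> psums ?\<alpha>. W ?n w) =
      (\<Sum>z\<in>?U \<times> ?A \<times> ?B. W ?n (?g z))"
    by (rule sum.reindex_bij_betw[symmetric])
  also have "\<dots> = (\<Sum>(u, a, b)\<in>?U \<times> ?A \<times> ?B. c k * (hom (fac k) / fac k) *
      (hom (W (k + m) u) * (W k a * (hom ^^ Suc k) (W m b))))"
    by (intro sum.cong) (clarsimp simp: W_glue[unfolded One_nat_def] mult.assoc simp del: psums_Cons funpow.simps)+
  also have "\<dots> = c k * (hom (fac k) / fac k) *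
      ((\<Sum>u\<in>?U. hom (W (k + m) u)) * ((\<Sum>a\<in>?A. W k a) * (\<Sum>b\<in>?B. (hom ^^ Suc k) (W m b))))"
    by (simp only: sum.cartesian_product[symmetric] sum_distrib_left[symmetric]
        sum_distrib_right[symmetric])
  also have "?U = {w. w permutes {1..k + m} \<and> descents (k + m) w \<subseteq> psums [k, m]}"
  proof -
    have "i \<in> {k} \<longleftrightarrow> i \<in> psums [k, m]" if "i \<in> descents (k + m) w" for i w
      using that by (auto simp: descents_def)
    then show ?thesis unfolding grassmann_perms_def by blast
  qed
  finally show ?thesis
    unfolding subset_sum_def by (simp only: hom_sum pow.hom_sum mult.assoc)
qed

text \<open>For the part \<open>Suc d\<close> that begins at \<open>k\<close>, the factorials of \<open>k\<close> and \<open>m\<close> cancel between the three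
  pieces, and what remains differs from \<open>hom (fac N) / den 0 \<alpha>\<close> only by \<open>c k\<close> and by the quotient
  of the factorials of \<open>Suc d\<close> and \<open>d\<close>. By \<open>bracket\<close> this is an increment of \<open>psi\<close>.\<close>

lemma subset_sum_eq: "subset_sum (sum_list \<alpha>) \<alpha> = fac (sum_list \<alpha>) / den 0 \<alpha>"
proof (induction "sum_list \<alpha>" arbitrary: \<alpha> rule: less_induct)
  case less
  let ?n = "sum_list \<alpha>"
  show ?case
  proof (cases ?n)
    case 0
    have S: "{w. w permutes {1..0::nat} \<and> descents 0 w \<subseteq> psums \<alpha>} = {id}"
      by (auto simp: descents_def)
    have "den 0 \<alpha> = 1"
      using 0 by (induction \<alpha>) (auto simp: fac_0)
    then show ?thesis unfolding subset_sum_def 0 S by (simp add: W_0 fac_0)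
  next
    case (Suc N)
    let ?S = "{s. s < length \<alpha> \<and> 0 < \<alpha> ! s}"
    let ?\<sigma> = "partial_sum \<alpha>"
    let ?Q = "\<lambda>k. {w. w permutes {1..?n} \<and> w (Suc k) = 1 \<and> descents ?n w \<subseteq> psums \<alpha>}"
    have fin: "finite {w. w permutes {1..?n} \<and> P w}" for P
      by (rule finite_subset[OF _ finite_permutations[of "{1..?n}"]]) auto
    have block: "sum (W ?n) (?Q (?\<sigma> s)) = hom (fac N) / den 0 \<alpha> * (psi (?\<sigma> (Suc s)) - psi (?\<sigma> s))"
      if s: "s \<in> ?S" for s
    proof -
      define xs where "xs = take s \<alpha>"
      define ys where "ys = drop (Suc s) \<alpha>"
      obtain d where d: "\<alpha> ! s = Suc d" using s by (metis gr0_conv_Suc mem_Collect_eq)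
      have \<alpha>: "\<alpha> = xs @ Suc d # ys"
        using s d id_take_nth_drop[of s \<alpha>] by (simp add: xs_def ys_def)
      define k where "k = ?\<sigma> s"
      define m where "m = d + sum_list ys"
      have k: "sum_list xs = k" by (simp add: k_def xs_def partial_sum_def)
      have \<sigma>: "?\<sigma> (Suc s) = k + Suc d" using s d by (simp add: partial_sum_Suc k_def)
      have n: "?n = Suc (k + m)" unfolding \<alpha> by (simp add: k m_def)
      then have N: "N = k + m" using Suc by simp
      have IH: "subset_sum (k + m) [k, m] = fac N / (fac k * (hom ^^ k) (fac m))"
          "subset_sum k xs = fac k / den 0 xs" "subset_sum m (d # ys) = fac m / den 0 (d # ys)"
        using less[of "[k, m]"] less[of xs] less[of "d # ys"] n k by (simp_all add: N m_def)
      have Q: "sum (W ?n) (?Q (?\<sigma> s)) = c k * (hom (fac k) / fac k) *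
          hom (subset_sum (k + m) [k, m]) * subset_sum k xs * (hom ^^ Suc k) (subset_sum m (d # ys))"
        using sum_one_at[OF k m_def] unfolding n k_def[symmetric] \<alpha>[symmetric] .
      define X where "X = den 0 xs"
      define Y where "Y = den (Suc k + d) ys"
      define F where "F = (hom ^^ Suc k) (fac d)"
      define G where "G = (hom ^^ k) (fac (Suc d))"
      define H where "H = (hom ^^ Suc k) (fac m)"
      have nz: "X \<noteq> 0" "Y \<noteq> 0" "F \<noteq> 0" "G \<noteq> 0" "H \<noteq> 0" "fac k \<noteq> 0" "hom (fac k) \<noteq> 0"
        by (simp_all add: X_def Y_def F_def G_def H_def den_nonzero fac_nonzero)
      have dens: "den 0 \<alpha> = X * G * Y"
        unfolding \<alpha> by (simp add: den_append X_def G_def Y_def k)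
      have right: "(hom ^^ Suc k) (subset_sum m (d # ys)) = H / (F * Y)"
        unfolding IH pow.hom_div hom_den H_def F_def Y_def by (simp add: pow.hom_mult hom_den)
      have mid: "hom (subset_sum (k + m) [k, m]) = hom (fac N) / (hom (fac k) * H)"
        unfolding IH H_def by (simp add: hom_div hom_mult)
      have "c k * G = (psi (k + Suc d) - psi k) * F" unfolding G_def F_def by (rule bracket)
      then have ck: "c k = (psi (k + Suc d) - psi k) * F / G" using nz by (simp add: field_simps)
      show ?thesis
        unfolding Q dens right mid IH(2) \<sigma> unfolding k_def[symmetric] X_def[symmetric] ck
        using nz by (simp add: mult_ac)
    qed
    \<comment> \<open>The value 1 after position \<open>k\<close> causes a descent at \<open>k\<close>.\<close>
    have zero: "?Q k = {}" if "k < ?n" "k \<notin> psums \<alpha>" for k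
    proof (rule equals0I)
      fix w assume "w \<in> ?Q k"
      then have w: "w permutes {1..?n}" "w (Suc k) = 1" "descents ?n w \<subseteq> psums \<alpha>" by auto
      have "k \<noteq> 0" using that(2) zero_in_psums by metis
      then have "w k \<in> {1..?n}" using permutes_in_image[OF w(1), of k] that(1) by auto
      moreover have "w k \<noteq> w (Suc k)" using permutes_inj[OF w(1)] by (simp add: inj_eq)
      ultimately have "k \<in> descents ?n w" using w(2) that \<open>k \<noteq> 0\<close> by (auto simp: descents_def)
      then show False using w(3) that by blast
    qed
    have "subset_sum ?n \<alpha> = (\<Sum>k<?n. sum (W ?n) (?Q k))"
    proof -
      have un: "{w. w permutes {1..?n} \<and> descents ?n w \<subseteq> psums \<alpha>} = (\<Union>k<?n. ?Q k)"
      proof (intro equalityI subsetI)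
        fix w assume w: "w \<in> {w. w permutes {1..?n} \<and> descents ?n w \<subseteq> psums \<alpha>}"
        then have "w ` {1..?n} = {1..?n}" using permutes_image[of w "{1..?n}"] by simp
        moreover have "1 \<in> {1..?n}" using Suc by simp
        ultimately obtain i where "i \<in> {1..?n}" "w i = 1" by (metis imageE)
        then show "w \<in> (\<Union>k<?n. ?Q k)" using w by (intro UN_I[of "i - 1"]) auto
      qed auto
      have disj: "?Q i \<inter> ?Q j = {}" if "i \<noteq> j" for i j
      proof (rule equals0I)
        fix w assume "w \<in> ?Q i \<inter> ?Q j"
        then have "inj w" "w (Suc i) = w (Suc j)" by (auto intro: permutes_inj)
        then show False using that by (auto dest: injD)
      qed
      show ?thesis
        unfolding subset_sum_def un
        by (rule sum.UNION_disjoint[OF finite_lessThan]) (intro ballI impI fin disj, assumption?)+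
    qed
    also have "\<dots> = (\<Sum>k\<in>psums \<alpha> \<inter> {..<?n}. sum (W ?n) (?Q k))"
    proof (rule sum.mono_neutral_right, simp, simp, intro ballI)
      fix k assume "k \<in> {..<?n} - psums \<alpha> \<inter> {..<?n}"
      then have "?Q k = {}" by (intro zero) auto
      then show "sum (W ?n) (?Q k) = 0" by (simp only: sum.empty)
    qed
    also have "\<dots> = (\<Sum>s\<in>?S. sum (W ?n) (?Q (?\<sigma> s)))"
      by (rule sum.reindex_bij_betw[OF bij_betw_partial_sum, symmetric])
    also have "\<dots> = (\<Sum>s\<in>?S. hom (fac N) / den 0 \<alpha> * (psi (?\<sigma> (Suc s)) - psi (?\<sigma> s)))"
      using block by (intro sum.cong) auto
    \<comment> \<open>Zero parts give zero increments, so they may be included to telescope.\<close>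
    also have "\<dots> = (\<Sum>s<length \<alpha>. hom (fac N) / den 0 \<alpha> * (psi (?\<sigma> (Suc s)) - psi (?\<sigma> s)))"
      by (rule sum.mono_neutral_left) (auto simp: partial_sum_Suc)
    also have "\<dots> = hom (fac N) / den 0 \<alpha> * psi ?n"
      unfolding sum_distrib_left[symmetric]
      using sum_lessThan_telescope[of "\<lambda>s. psi (?\<sigma> s)" "length \<alpha>"]
      by (simp add: psi_0 partial_sum_length)
    also have "\<dots> = fac ?n / den 0 \<alpha>" using Suc by (simp add: fac_Suc)
    finally show ?thesis .
  qed
qed

text \<open>Sorting the permutations counted by \<open>subset_sum\<close> by descent composition makes the multinomial
  coefficients sums of ribbon numbers over coarsenings, to which Moebius inversion applies. For the
  determinant, the entries are values of \<open>h p r\<close>, the shifted reciprocal factorial of a block from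
  \<open>p\<close> to \<open>r\<close>, which is 1 on empty blocks and 0 if \<open>r < p\<close>.\<close>

theorem ribbon_formulas:
  assumes "composition_of n \<alpha>"
  shows "(\<Sum>w\<in>ribbon_perms \<alpha>. W (sum_list \<alpha>) w) =
      (\<Sum>\<beta> | composition_of n \<beta> \<and> refined_by \<beta> \<alpha>. (-1) ^ (length \<alpha> - length \<beta>) *
        (fac n / (\<Prod>s<length \<beta>. (hom ^^ partial_sum \<beta> s) (fac (\<beta> ! s)))))"
    and "(\<Sum>\<beta> | composition_of n \<beta> \<and> refined_by \<beta> \<alpha>. (-1) ^ (length \<alpha> - length \<beta>) *
        (fac n / (\<Prod>s<length \<beta>. (hom ^^ partial_sum \<beta> s) (fac (\<beta> ! s))))) =
      fac n * det (mat (length \<alpha>) (length \<alpha>) (\<lambda>(i, j). (hom ^^ partial_sum \<alpha> i)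
        (recip_fact fac (int (partial_sum \<alpha> (j + 1)) - int (partial_sum \<alpha> i)))))"
proof -
  have pos: "\<forall>a\<in>set \<alpha>. a > 0" and n: "sum_list \<alpha> = n" using assms by (auto simp: composition_of_def)
  let ?sg = "\<lambda>\<beta>. (-1) ^ (length \<alpha> - length \<beta>) :: 'a"
  let ?R = "\<lambda>\<gamma>. \<Sum>w | w permutes {1..n} \<and> descent_comp n w = \<gamma>. W n w"
  have fin: "finite {w. w permutes {1..n} \<and> P w}" for P
    by (rule finite_subset[OF _ finite_permutations[of "{1..n}"]]) auto
  have comp: "composition_of n \<beta>" if "\<beta> \<in> coarsenings \<alpha>" for \<beta>
    using that composition_coarsenings[OF assms] by blast
  have refined: "(\<Sum>\<gamma>\<in>coarsenings \<beta>. ?R \<gamma>) = fac n / den 0 \<beta>" if "\<beta> \<in> coarsenings \<alpha>" for \<beta>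
  proof -
    have "(\<Sum>\<gamma>\<in>coarsenings \<beta>. ?R \<gamma>) =
        (\<Sum>\<gamma>\<in>coarsenings \<beta>. sum (W n) {w \<in> {w. w permutes {1..n} \<and> descent_comp n w \<in> coarsenings \<beta>}.
          descent_comp n w = \<gamma>})"
      by (intro sum.cong) (auto intro!: arg_cong2[where f = sum])
    also have "\<dots> = sum (W n) {w. w permutes {1..n} \<and> descent_comp n w \<in> coarsenings \<beta>}"
      by (rule sum.group[OF fin finite_coarsenings]) auto
    also have "{w. w permutes {1..n} \<and> descent_comp n w \<in> coarsenings \<beta>} =
        {w. w permutes {1..n} \<and> descents n w \<subseteq> psums \<beta>}"
      using descent_comp_in_coarsenings comp[OF that] by auto
    finally show ?thesis
      using subset_sum_eq[of \<beta>] comp[OF that] by (simp add: subset_sum_def composition_of_def)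
  qed
  show "(\<Sum>w\<in>ribbon_perms \<alpha>. W (sum_list \<alpha>) w) =
      (\<Sum>\<beta> | composition_of n \<beta> \<and> refined_by \<beta> \<alpha>. ?sg \<beta> *
        (fac n / (\<Prod>s<length \<beta>. (hom ^^ partial_sum \<beta> s) (fac (\<beta> ! s)))))"
  proof -
    have "(\<Sum>w\<in>ribbon_perms \<alpha>. W (sum_list \<alpha>) w) = ?R \<alpha>" by (simp add: ribbon_perms_def n)
    also have "\<dots> = (\<Sum>\<beta>\<in>coarsenings \<alpha>. ?sg \<beta> * (\<Sum>\<gamma>\<in>coarsenings \<beta>. ?R \<gamma>))"
      by (rule moebius_coarsenings[OF pos, symmetric])
    also have "\<dots> = (\<Sum>\<beta>\<in>coarsenings \<alpha>. ?sg \<beta> *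
        (fac n / (\<Prod>s<length \<beta>. (hom ^^ partial_sum \<beta> s) (fac (\<beta> ! s)))))"
      by (intro sum.cong refl) (simp only: refined den_prod add_0)
    finally show ?thesis unfolding composition_coarsenings[OF assms] .
  qed
  define h where "h p r = (hom ^^ p) (recip_fact fac (int r - int p))" for p r
  have "(\<Sum>\<beta>\<in>coarsenings \<alpha>. ?sg \<beta> * (fac n / (\<Prod>s<length \<beta>. (hom ^^ partial_sum \<beta> s) (fac (\<beta> ! s)))))
      = fac n * (\<Sum>\<beta>\<in>coarsenings \<alpha>. ?sg \<beta> *
          (\<Prod>s<length \<beta>. h (0 + partial_sum \<beta> s) (0 + partial_sum \<beta> (s + 1))))"
    unfolding sum_distrib_left
  proof (rule sum.cong[OF refl])
    fix \<beta>
    have "h (partial_sum \<beta> s) (partial_sum \<beta> (Suc s)) = 1 / (hom ^^ partial_sum \<beta> s) (fac (\<beta> ! s))"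
      if "s < length \<beta>" for s
      using that by (simp add: h_def recip_fact_def partial_sum_Suc pow.hom_div)
    then show "?sg \<beta> * (fac n / (\<Prod>s<length \<beta>. (hom ^^ partial_sum \<beta> s) (fac (\<beta> ! s)))) =
      fac n * (?sg \<beta> * (\<Prod>s<length \<beta>. h (0 + partial_sum \<beta> s) (0 + partial_sum \<beta> (s + 1))))"
      by (simp add: prod_dividef)
  qed
  also have "\<dots> = fac n * det (mat (length \<alpha>) (length \<alpha>)
      (\<lambda>(i, j). h (0 + partial_sum \<alpha> i) (0 + partial_sum \<alpha> (j + 1))))"
    by (subst det_partial_sums[OF _ _ pos, symmetric]) (auto simp: h_def recip_fact_def fac_0)
  finally show "(\<Sum>\<beta> | composition_of n \<beta> \<and> refined_by \<beta> \<alpha>. ?sg \<beta> *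
        (fac n / (\<Prod>s<length \<beta>. (hom ^^ partial_sum \<beta> s) (fac (\<beta> ! s))))) =
      fac n * det (mat (length \<alpha>) (length \<alpha>) (\<lambda>(i, j). (hom ^^ partial_sum \<alpha> i)
        (recip_fact fac (int (partial_sum \<alpha> (j + 1)) - int (partial_sum \<alpha> i)))))"
    unfolding composition_coarsenings[OF assms] h_def add_0 .
qed

end

section \<open>Inversions\<close>

lemma sum_split_at:
  fixes f :: "nat \<Rightarrow> 'a::comm_monoid_add"
  shows "sum f {1..Suc (k + m)} = sum f {1..k} + f (Suc k) + (\<Sum>i\<in>{1..m}. f (Suc k + i))"
    and "sum f {1..k + m} = sum f {1..k} + (\<Sum>i\<in>{1..m}. f (k + i))"
  by (induction m) (simp_all add: add.assoc)

lemma inversions_sum: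
  "inversions n w = (\<Sum>i\<in>{1..n}. \<Sum>j\<in>{1..n}. of_bool (i < j \<and> w j < w i))"
proof -
  have "{(i, j). 1 \<le> i \<and> i < j \<and> j \<le> n \<and> w j < w i} =
      {p \<in> {1..n} \<times> {1..n}. fst p < snd p \<and> w (snd p) < w (fst p)}" by auto
  then have "inversions n w =
      (\<Sum>p\<in>{p \<in> {1..n} \<times> {1..n}. fst p < snd p \<and> w (snd p) < w (fst p)}. 1)"
    unfolding inversions_def by (simp only: card_eq_sum)
  also have "\<dots> = (\<Sum>p\<in>{1..n} \<times> {1..n}. of_bool (fst p < snd p \<and> w (snd p) < w (fst p)))"
    unfolding of_bool_def by (rule sum.inter_filter) simp
  also have "\<dots> = (\<Sum>i\<in>{1..n}. \<Sum>j\<in>{1..n}. of_bool (i < j \<and> w j < w i))"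
    unfolding sum.cartesian_product case_prod_unfold ..
  finally show ?thesis .
qed

text \<open>The value 1 forms an inversion with each of the \<open>k\<close> entries to its left. The number of
  inversions between the two sides depends only on which values occur on each side, hence on \<open>u\<close>
  alone; and \<open>u\<close> has no other inversions, being increasing on both sides.\<close>

lemma inversions_glue:
  assumes "u \<in> grassmann_perms k m" "a permutes {1..k}" "b permutes {1..m}"
  shows "inversions (Suc (k + m)) (glue k u a b) =
    k + inversions (k + m) u + inversions k a + inversions m b"
proof -
  let ?w = "glue k u a b"
  note mono = grassmann_perms_strict_mono[OF assms(1)]
  have less1: "u x < u y \<longleftrightarrow> x < y" if "x \<in> {1..k}" "y \<in> {1..k}" for x y
    using strict_mono_on_less[OF mono(1)] that by auto
  have less2: "u (k + x) < u (k + y) \<longleftrightarrow> x < y" if "x \<in> {1..m}" "y \<in> {1..m}" for x y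
    using strict_mono_on_less[OF mono(2), of "k + x" "k + y"] that by auto
  have up: "u permutes {1..k + m}" using assms(1) by (simp add: grassmann_perms_def)
  have ra: "a x \<in> {1..k}" if "x \<in> {1..k}" for x using permutes_in_image[OF assms(2)] that by blast
  have rb: "b x \<in> {1..m}" if "x \<in> {1..m}" for x using permutes_in_image[OF assms(3)] that by blast
  have pos: "0 < u (a x)" if "x \<in> {1..k}" for x
    using permutes_in_image[OF up, of "a x"] ra[OF that] by auto
  note w = glue_low[OF assms(2,3)] glue_mid[OF assms(2,3)] glue_high[OF assms(2,3)]
  let ?F = "\<lambda>i j. of_bool (i < j \<and> ?w j < ?w i) :: nat"
  let ?cross = "\<Sum>i\<in>{1..k}. \<Sum>j\<in>{1..m}. of_bool (u (k + j) < u i) :: nat"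
  have low_low: "(\<Sum>i\<in>{1..k}. \<Sum>j\<in>{1..k}. ?F i j) = inversions k a"
    unfolding inversions_sum
    by (intro sum.cong refl) (use less1 ra in \<open>simp only: w Suc_less_eq\<close>)
  have low_mid: "(\<Sum>i\<in>{1..k}. ?F i (Suc k)) = k"
  proof -
    have "(\<Sum>i\<in>{1..k}. ?F i (Suc k)) = (\<Sum>i\<in>{1..k}. 1)"
      by (intro sum.cong refl) (use pos w in auto)
    then show ?thesis by simp
  qed
  have low_high: "(\<Sum>i\<in>{1..k}. \<Sum>j\<in>{1..m}. ?F i (Suc k + j)) = ?cross"
  proof -
    have "(\<Sum>i\<in>{1..k}. \<Sum>j\<in>{1..m}. ?F i (Suc k + j)) =
        (\<Sum>i\<in>{1..k}. \<Sum>j\<in>{1..m}. of_bool (u (k + b j) < u (a i)))"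
      by (intro sum.cong refl) (simp only: w Suc_less_eq, auto)
    also have "\<dots> = (\<Sum>i\<in>{1..k}. \<Sum>j\<in>{1..m}. of_bool (u (k + j) < u (a i)))"
      by (intro sum.cong refl sum.reindex_bij_betw[OF permutes_imp_bij[OF assms(3)]])
    also have "\<dots> = ?cross"
      by (rule sum.reindex_bij_betw[OF permutes_imp_bij[OF assms(2)]])
    finally show ?thesis .
  qed
  have mid_low: "(\<Sum>j\<in>{1..k}. ?F (Suc k) j) = 0" and mid_high: "(\<Sum>j\<in>{1..m}. ?F (Suc k) (Suc k + j)) = 0"
    by (auto simp: w(2)[unfolded One_nat_def] w(3)[unfolded One_nat_def, simplified] intro!: sum.neutral)
  have high_low: "(\<Sum>i\<in>{1..m}. \<Sum>j\<in>{1..k}. ?F (Suc k + i) j) = 0"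
    and high_mid: "(\<Sum>i\<in>{1..m}. ?F (Suc k + i) (Suc k)) = 0"
    by (auto intro!: sum.neutral)
  have high_high: "(\<Sum>i\<in>{1..m}. \<Sum>j\<in>{1..m}. ?F (Suc k + i) (Suc k + j)) = inversions m b"
    unfolding inversions_sum
    by (intro sum.cong refl) (use less2 rb in \<open>simp only: w Suc_less_eq nat_add_left_cancel_less\<close>)
  have "inversions (Suc (k + m)) ?w = k + ?cross + inversions k a + inversions m b"
    unfolding inversions_sum[of "Suc (k + m)"] sum_split_at(1) sum.distrib
    by (simp only: low_low low_mid low_high mid_low mid_high high_low high_mid high_high) simp
  moreover have "inversions (k + m) u = ?cross"
  proof -
    let ?G = "\<lambda>i j. of_bool (i < j \<and> u j < u i) :: nat"
    have "(\<Sum>i\<in>{1..k}. \<Sum>j\<in>{1..k}. ?G i j) = 0" "(\<Sum>i\<in>{1..m}. \<Sum>j\<in>{1..k}. ?G (k + i) j) = 0"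
      "(\<Sum>i\<in>{1..m}. \<Sum>j\<in>{1..m}. ?G (k + i) (k + j)) = 0"
      using less1 less2 by (auto intro!: sum.neutral)
    moreover have "(\<Sum>i\<in>{1..k}. \<Sum>j\<in>{1..m}. ?G i (k + j)) = ?cross"
      by (intro sum.cong) auto
    ultimately show ?thesis unfolding inversions_sum sum_split_at(2) sum.distrib by linarith
  qed
  ultimately show ?thesis by simp
qed

section \<open>The three weights\<close>

lemma field_hom_id: "field_hom (id :: 'a::field \<Rightarrow> 'a)"
  by unfold_locales auto

lemma ribbon_weight_count:
  "ribbon_weight (id :: rat \<Rightarrow> rat) fact (\<lambda>_. 1) of_nat (\<lambda>_ _. 1)"
proof -
  interpret field_hom "id :: rat \<Rightarrow> rat" by (rule field_hom_id)
  show ?thesis by unfold_locales (simp_all add: id_funpow)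
qed

text \<open>Evaluating at \<open>q = 1\<close> gives the positive integer \<open>j + 1\<close>.\<close>

lemma sum_qvar_nonzero: "(\<Sum>i<Suc j. qvar ^ i) \<noteq> 0"
proof -
  have pow: "qvar ^ i = Fract ([:0, 1:] ^ i) 1" for i
    by (induction i) (simp_all add: qvar_def One_fract_def)
  have "(\<Sum>i<n. qvar ^ i) = Fract (\<Sum>i<n. [:0, 1:] ^ i) 1" for n
    by (induction n) (simp_all add: pow Zero_fract_def)
  moreover have "(\<Sum>i<Suc j. [:0, 1:] ^ i) \<noteq> (0 :: rat poly)"
  proof
    assume "(\<Sum>i<Suc j. [:0, 1:] ^ i) = (0 :: rat poly)"
    then have "poly (\<Sum>i<Suc j. [:0, 1:] ^ i) 1 = (0 :: rat)" by (simp only: poly_0)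
    then show False by (simp add: poly_sum poly_power del: sum.lessThan_Suc)
  qed
  ultimately show ?thesis by (simp add: Zero_fract_def eq_fract del: sum.lessThan_Suc)
qed

lemma ribbon_weight_inversions:
  "ribbon_weight id q_fact (\<lambda>k. qvar ^ k) (\<lambda>k. \<Sum>i<k. qvar ^ i) (\<lambda>n w. qvar ^ inversions n w)"
proof -
  interpret field_hom "id :: rat poly fract \<Rightarrow> rat poly fract" by (rule field_hom_id)
  have Suc: "q_fact (Suc d) = q_fact d * (\<Sum>i<Suc d. qvar ^ i)" for d
    by (simp add: q_fact_def)
  have nz: "q_fact d \<noteq> 0" for d
    by (induction d) (simp_all add: Suc sum_qvar_nonzero q_fact_def[of 0] del: sum.lessThan_Suc)
  have diff: "(\<Sum>i<k + d. qvar ^ i) - (\<Sum>i<k. qvar ^ i) = qvar ^ k * (\<Sum>i<d. qvar ^ i)" for k d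
    by (induction d) (simp_all add: algebra_simps power_add)
  show ?thesis
  proof (unfold_locales, goal_cases)
    case (5 k d)
    show ?case by (simp only: id_funpow id_apply diff Suc) (simp only: mult_ac)
  next
    case 6
    show ?case by (simp add: inversions_sum)
  next
    case (7 u k m a b)
    then show ?case
      by (simp add: inversions_glue[unfolded One_nat_def] nz id_funpow power_add)
  qed (simp_all add: nz q_fact_def[of 0])
qed

lemma field_hom_phi: "field_hom phi"
proof -
  have "phi 0 + phi 0 = phi 0 + 0" by (simp flip: phi_add)
  then have "phi 0 = 0" by (simp only: add_left_cancel)
  then show ?thesis by unfold_locales (simp_all add: phi_add phi_mult phi_1)
qed

lemma tvar_eq_iff [simp]: "tvar r = tvar s \<longleftrightarrow> r = s"
proof -
  have "Poly_Mapping.single r (1::nat) = Poly_Mapping.single s 1 \<longleftrightarrow> r = s" for r s :: int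
    by (metis lookup_single_eq lookup_single_not_eq zero_neq_one)
  moreover have "Poly_Mapping.single m (1::rat) = Poly_Mapping.single m' 1 \<longleftrightarrow> m = m'"
    for m m' :: "int \<Rightarrow>\<^sub>0 nat"
    by (metis lookup_single_eq lookup_single_not_eq zero_neq_one)
  ultimately show ?thesis by (simp add: tvar_def eq_fract)
qed

lemma tvar_nonzero [simp]: "tvar r \<noteq> 0"
proof -
  have "Poly_Mapping.single (Poly_Mapping.single r (1::nat)) (1::rat) \<noteq> 0"
    by (metis lookup_single_eq lookup_zero zero_neq_one)
  then show ?thesis by (simp add: tvar_def Zero_fract_def eq_fract)
qed

lemma tpow_diff: "tpow (qexp a - qexp b) = tvar (int a) / tvar (int b)"
proof -
  let ?f = "qexp a - qexp b"
  have lookup: "Poly_Mapping.lookup ?f r = of_bool (r = int a) - of_bool (r = int b)" for r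
    by (simp add: qexp_def lookup_minus lookup_single when_def)
  have "tpow ?f = (\<Prod>r\<in>{int a, int b}. tvar r powi Poly_Mapping.lookup ?f r)"
    unfolding tpow_def
  proof (rule prod.mono_neutral_left)
    show "Poly_Mapping.keys ?f \<subseteq> {int a, int b}"
      by (auto simp: in_keys_iff lookup split: if_splits)
  qed (auto simp: in_keys_iff)
  also have "\<dots> = tvar (int a) / tvar (int b)"
    by (cases "a = b") (simp_all add: lookup power_int_minus divide_inverse)
  finally show ?thesis .
qed

lemma phi_funpow_qt_fact:
  "(phi ^^ k) (qt_fact d) = (\<Prod>i<d. 1 - tvar (int (k + d)) / tvar (int (k + i)))"
proof -
  interpret field_hom "phi ^^ k" by (rule field_hom_funpow[OF field_hom_phi])
  have "(phi ^^ k) (tvar r) = tvar (r + int k)" for r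
    by (induction k) (simp_all add: phi_tvar add_ac)
  then show ?thesis
    by (simp add: qt_fact_def tpow_diff hom_prod hom_minus hom_div add.commute)
qed

text \<open>With \<open>x\<^sub>i\<close> for the \<open>i\<close>-th indeterminate, the bracket identity is
  \<open>(x\<^sub>k / x\<^sub>0) (1 - x\<^sub>r / x\<^sub>k) = (1 - x\<^sub>r / x\<^sub>0) - (1 - x\<^sub>k / x\<^sub>0)\<close> for \<open>r = k + d + 1\<close>: the
  first factor of the shifted factorial of \<open>d + 1\<close> is \<open>1 - x\<^sub>r / x\<^sub>k\<close>, and the remaining ones form
  the factorial of \<open>d\<close> shifted once more.\<close>

lemma ribbon_weight_wt:
  "ribbon_weight phi qt_fact (\<lambda>k. tvar (int k) / tvar 0) (\<lambda>k. 1 - tvar (int k) / tvar 0) wt"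
proof -
  interpret field_hom phi by (rule field_hom_phi)
  have qexp_0: "qexp 0 = 1" by (simp add: qexp_def)
  show ?thesis
  proof (unfold_locales, goal_cases)
    case (1 n)
    show ?case unfolding qt_fact_def tpow_diff by (auto simp: divide_eq_eq)
  next
    case (5 k d)
    let ?x = "\<lambda>i. tvar (int i)"
    have step: "(phi ^^ k) (qt_fact (Suc d)) =
        (1 - ?x (k + Suc d) / ?x k) * (phi ^^ Suc k) (qt_fact d)"
      unfolding phi_funpow_qt_fact prod.lessThan_Suc_shift by simp
    show ?case unfolding step by (simp add: field_simps del: funpow.simps)
  next
    case 6
    show ?case by (subst wt.simps) simp
  next
    case (7 u k m a b)
    show ?case
      using wt_glue[OF 7] tpow_diff[of k 0] by (simp add: qexp_0 del: funpow.simps)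
  qed (simp_all add: qt_fact_def)
qed

theorem proposition9p1:
  fixes n :: nat and \<alpha> :: "nat list"
  assumes "composition_of n \<alpha>"
  shows
    "(of_nat (ribbon \<alpha>) =
        (\<Sum>\<beta> | composition_of n \<beta> \<and> refined_by \<beta> \<alpha>.
          (-1) ^ (length \<alpha> - length \<beta>) * multinom n \<beta>) \<and>
      (\<Sum>\<beta> | composition_of n \<beta> \<and> refined_by \<beta> \<alpha>.
          (-1) ^ (length \<alpha> - length \<beta>) * multinom n \<beta>) =
        fact n * det (mat (length \<alpha>) (length \<alpha>) (\<lambda>(i, j).
          recip_fact fact (int (partial_sum \<alpha> (j + 1)) - int (partial_sum \<alpha> i))))) \<and>
     (q_ribbon \<alpha> =
        (\<Sum>\<beta> | composition_of n \<beta> \<and> refined_by \<beta> \<alpha>.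
          (-1) ^ (length \<alpha> - length \<beta>) * q_multinom n \<beta>) \<and>
      (\<Sum>\<beta> | composition_of n \<beta> \<and> refined_by \<beta> \<alpha>.
          (-1) ^ (length \<alpha> - length \<beta>) * q_multinom n \<beta>) =
        q_fact n * det (mat (length \<alpha>) (length \<alpha>) (\<lambda>(i, j).
          recip_fact q_fact (int (partial_sum \<alpha> (j + 1)) - int (partial_sum \<alpha> i))))) \<and>
     (qt_ribbon \<alpha> =
        (\<Sum>\<beta> | composition_of n \<beta> \<and> refined_by \<beta> \<alpha>.
          (-1) ^ (length \<alpha> - length \<beta>) * qt_multinom n \<beta>) \<and>
      (\<Sum>\<beta> | composition_of n \<beta> \<and> refined_by \<beta> \<alpha>.
          (-1) ^ (length \<alpha> - length \<beta>) * qt_multinom n \<beta>) =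
        qt_fact n * det (mat (length \<alpha>) (length \<alpha>) (\<lambda>(i, j).
          (phi ^^ partial_sum \<alpha> i)
            (recip_fact qt_fact (int (partial_sum \<alpha> (j + 1)) - int (partial_sum \<alpha> i))))))"
proof -
  have "(\<Sum>w\<in>ribbon_perms \<alpha>. 1) = (of_nat (ribbon \<alpha>) :: rat)" by (simp add: ribbon_def)
  note count = ribbon_weight.ribbon_formulas[OF ribbon_weight_count assms,
      unfolded id_funpow id_apply multinom_def[symmetric] this]
  note inv = ribbon_weight.ribbon_formulas[OF ribbon_weight_inversions assms,
      unfolded id_funpow id_apply q_multinom_def[symmetric] q_ribbon_def[symmetric]]
  note qt = ribbon_weight.ribbon_formulas[OF ribbon_weight_wt assms,
      unfolded qt_multinom_def[symmetric] qt_ribbon_def[symmetric]]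
  show ?thesis by (intro conjI count inv qt)
qed

end
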